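(* The Veronese orbitope $\mathcal{V}_{3,4}=\mathrm{conv}(\nu_4(\mathbb{S}^2))$ is a spectrahedron. It consists of all $\lambda=(\lambda_\alpha)\in\mathbb{R}^{15}$ (indices $\alpha\in\mathbb{N}^3$ with $|\alpha|=4$) for which the Hankel matrix $$K_\lambda=\begin{pmatrix}\lambda_{400}&\lambda_{220}&\lambda_{202}&\lambda_{310}&\lambda_{301}&\lambda_{211}\\ \lambda_{220}&\lambda_{040}&\lambda_{022}&\lambda_{130}&\lambda_{121}&\lambda_{031}\\ \lambda_{202}&\lambda_{022}&\lambda_{004}&\lambda_{112}&\lambda_{103}&\lambda_{013}\\ \lambda_{310}&\lambda_{130}&\lambda_{112}&\lambda_{220}&\lambda_{211}&\lambda_{121}\\ \lambda_{301}&\lambda_{121}&\lambda_{103}&\lambda_{211}&\lambda_{202}&\lambda_{112}\\ \lambda_{211}&\lambda_{031}&\lambda_{013}&\lambda_{121}&\lambda_{112}&\lambda_{022}\end{pmatrix}$$ is positive semidefinite and which satisfy the equation $$\lambda_{400}+\lambda_{040}+\lambda_{004}+2\lambda_{220}+2\lambda_{202}+2\lambda_{022}=1.$$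
   Context: $\mathbb{S}^2\subset\mathbb{R}^3$ is the unit sphere and $\nu_4:\mathbb{R}^3\to\mathrm{Sym}_4\mathbb{R}^3\simeq\mathbb{R}^{15}$ is the Veronese map sending a vector to its fourth symmetric power. In the coordinates $\lambda_\alpha$ used here, $\nu_4(x,y,z)$ has coordinates $\lambda_\alpha=x^{\alpha_1}y^{\alpha_2}z^{\alpha_3}$. $\mathrm{conv}$ is the convex hull. A spectrahedron is a set of the form $\{x: A_0+\sum_i x_iA_i\succeq0\}$ with $A_i$ real symmetric matrices (equivalently, the intersection of the cone of positive semidefinite matrices with an affine-linear space). *)

theory Defs
  imports "HOL-Analysis.Analysis" "Jordan_Normal_Form.Matrix"
begin

text \<open>The matrix type below carries its size as a value, so that the size in the definition
  of a spectrahedron can be existentially quantified. Points are of type \<open>real ^ 'n\<close>, and the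
  infix dollar sign selects their components.\<close>

no_notation vec_index (infixl \<open>$\<close> 100)

definition psd_mat :: "real mat \<Rightarrow> bool" where
  "psd_mat A \<longleftrightarrow> square_mat A \<and> transpose_mat A = A \<and>
     (\<forall>v \<in> carrier_vec (dim_row A). 0 \<le> scalar_prod v (A *\<^sub>v v))"

definition affine_pencil ::
    "nat \<Rightarrow> real mat \<Rightarrow> ('n::finite \<Rightarrow> real mat) \<Rightarrow> real ^ 'n \<Rightarrow> real mat" where
  "affine_pencil m A0 A x =
     Matrix.mat m m (\<lambda>(i, j). A0 $$ (i, j) + (\<Sum>k\<in>UNIV. x $ k * A k $$ (i, j)))"

definition spectrahedron :: "(real ^ 'n::finite) set \<Rightarrow> bool" where
  "spectrahedron S \<longleftrightarrow> (\<exists>m A0 A.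
     A0 \<in> carrier_mat m m \<and> transpose_mat A0 = A0 \<and>
     (\<forall>k. A k \<in> carrier_mat m m \<and> transpose_mat (A k) = A k) \<and>
     S = {x. psd_mat (affine_pencil m A0 A x)})"

typedef quartic_exp = "{\<alpha> :: nat ^ 3. (\<Sum>i\<in>UNIV. \<alpha> $ i) = 4}"
  by (rule exI[of _ "vector [4, 0, 0]"]) (simp add: sum_3)

lemma finite_quartic_exps: "finite {\<alpha> :: nat ^ 3. (\<Sum>i\<in>UNIV. \<alpha> $ i) = 4}"
proof (rule finite_subset)
  show "{\<alpha> :: nat ^ 3. (\<Sum>i\<in>UNIV. \<alpha> $ i) = 4}
      \<subseteq> (\<lambda>(a, b, c). vector [a, b, c]) ` ({..4} \<times> {..4} \<times> {..4})"
  proof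
    fix \<alpha> :: "nat ^ 3"
    assume "\<alpha> \<in> {\<alpha>. (\<Sum>i\<in>UNIV. \<alpha> $ i) = 4}"
    then have "(\<alpha> $ 1, \<alpha> $ 2, \<alpha> $ 3) \<in> {..4} \<times> {..4} \<times> {..4}"
      by (auto simp: sum_3)
    moreover have "\<alpha> = vector [\<alpha> $ 1, \<alpha> $ 2, \<alpha> $ 3]"
      by (simp add: Finite_Cartesian_Product.vec_eq_iff forall_3 vector_3)
    ultimately show "\<alpha> \<in> (\<lambda>(a, b, c). vector [a, b, c]) ` ({..4} \<times> {..4} \<times> {..4})"
      by force
  qed
qed simp

instance quartic_exp :: finite
proof
  show "finite (UNIV :: quartic_exp set)"
    using finite_quartic_exps type_definition.univ[OF type_definition_quartic_exp]
    by (metis finite_imageI)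
qed

text \<open>The coordinate \<open>\<lambda>\<^sub>a\<^sub>b\<^sub>c\<close>. It is meaningful only for \<open>a + b + c = 4\<close>, since
  \<open>Abs_quartic_exp\<close> is unspecified elsewhere.\<close>

definition coord :: "real ^ quartic_exp \<Rightarrow> nat \<Rightarrow> nat \<Rightarrow> nat \<Rightarrow> real" where
  "coord l a b c = l $ Abs_quartic_exp (vector [a, b, c])"

definition veronese4 :: "real ^ 3 \<Rightarrow> real ^ quartic_exp" where
  "veronese4 v = (\<chi> \<alpha>. \<Prod>i\<in>UNIV. (v $ i) ^ (Rep_quartic_exp \<alpha> $ i))"

lemma coord_veronese4:
  "a + b + c = 4 \<Longrightarrow> coord (veronese4 v) a b c = (v $ 1) ^ a * (v $ 2) ^ b * (v $ 3) ^ c"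
  unfolding coord_def veronese4_def UNIV_3
  by (simp add: Abs_quartic_exp_inverse sum_3 vector_3 mult.assoc)

definition veronese_orbitope_3_4 :: "(real ^ quartic_exp) set" where
  "veronese_orbitope_3_4 = convex hull (veronese4 ` sphere 0 1)"

text \<open>Rows and columns correspond to the monomials
  \<open>x\<^sup>2, y\<^sup>2, z\<^sup>2, xy, xz, yz\<close>, in this order.\<close>

definition hankel_mat :: "real ^ quartic_exp \<Rightarrow> real mat" where
  "hankel_mat l = mat_of_rows_list 6
    [[coord l 4 0 0, coord l 2 2 0, coord l 2 0 2, coord l 3 1 0, coord l 3 0 1, coord l 2 1 1],
     [coord l 2 2 0, coord l 0 4 0, coord l 0 2 2, coord l 1 3 0, coord l 1 2 1, coord l 0 3 1],
     [coord l 2 0 2, coord l 0 2 2, coord l 0 0 4, coord l 1 1 2, coord l 1 0 3, coord l 0 1 3],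
     [coord l 3 1 0, coord l 1 3 0, coord l 1 1 2, coord l 2 2 0, coord l 2 1 1, coord l 1 2 1],
     [coord l 3 0 1, coord l 1 2 1, coord l 1 0 3, coord l 2 1 1, coord l 2 0 2, coord l 1 1 2],
     [coord l 2 1 1, coord l 0 3 1, coord l 0 1 3, coord l 1 2 1, coord l 1 1 2, coord l 0 2 2]]"

end

theory Submission
  imports Defs "HOL-Analysis.Cross3" "HOL-Computational_Algebra.Polynomial"
begin

text \<open>
  The description of the orbitope is dual to Hilbert's theorem that a nonnegative ternary quartic is a
  sum of squares of quadratic forms. A linear functional on quartics lies in the orbitope iff it is
  normalised by the value 1 at \<open>(x\<^sup>2 + y\<^sup>2 + z\<^sup>2)\<^sup>2\<close> and nonnegative on all nonnegative quartics, by
  separation of convex sets; the Hankel matrix is positive semidefinite iff the functional is nonnegative on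
  squares of quadratic forms. The two conditions agree because of Hilbert's theorem.

  The argument of Choi and Lam gives what is needed: for each nonzero nonnegative ternary quartic \<open>F\<close>
  there is a nonzero quadratic form \<open>q\<close> with \<open>q\<^sup>2 \<le> F\<close>
  (\<open>nonneg_ternary_quartic_dominates_square\<close>). If \<open>F\<close> has no zero this is compactness. At a
  zero, moved to the first axis by a linear substitution, \<open>F\<close> becomes
  \<open>x\<^sup>2 f + 2 x g + h\<close> with binary forms \<open>f, g, h\<close> of degrees 2, 3, 4 such that \<open>f h - g\<^sup>2\<close> is nonnegative.
  With a second zero on the second axis it even becomes \<open>x\<^sup>2 f + 2 x z g + z\<^sup>2 h\<close> with three binary quadratic
  forms. In both shapes either one can complete the square with an exact division by a linear form, or
  some binary form, most often the discriminant, is positive and compactness bounds it from below.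

  The domination property suffices for duality (\<open>hankel_nonneg_on_psd_cone\<close>). A functional that is
  nonnegative on squares but negative somewhere on the cone of nonnegative quartics would have a
  negative minimum on a compact base of the cone, and subtracting the dominated square from a
  minimiser contradicts minimality.

  That the orbitope is a spectrahedron follows by adding the affine equation to the
  Hankel matrix as two diagonal entries of opposite sign.
\<close>

section \<open>Homogeneous forms\<close>

text \<open>A coordinate-free description of homogeneous polynomials of degree \<open>d\<close>: sums of products of
  \<open>d\<close> linear functionals. In this form, stability under linear substitutions, on which every
  normalisation of zeros below rests, is a plain induction. Coefficients are extracted only in
  degree at most four.\<close>

inductive form :: "nat \<Rightarrow> ('a::real_vector \<Rightarrow> real) \<Rightarrow> bool" where
  form_const: "form 0 (\<lambda>v. c)"
| form_linear_mult: "linear l \<Longrightarrow> form d f \<Longrightarrow> form (Suc d) (\<lambda>v. l v * f v)"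
| form_add: "form d f \<Longrightarrow> form d g \<Longrightarrow> form d (\<lambda>v. f v + g v)"

lemma form_linear: "linear l \<Longrightarrow> form 1 l"
  using form_linear_mult[OF _ form_const[of 1], of l] by simp

lemma form_nth [intro]: "form 1 (\<lambda>v::real^3. v $ i)"
  by (intro form_linear linearI) auto

lemma form_scale: "form d f \<Longrightarrow> form d (\<lambda>v. c * f v)"
proof (induction rule: form.induct)
  case (form_linear_mult l d f)
  from form.form_linear_mult[OF this(1,3)] show ?case by (simp add: mult.left_commute)
qed (auto simp: distrib_left intro: form.intros)

lemma form_mult: "form d f \<Longrightarrow> form e g \<Longrightarrow> form (d + e) (\<lambda>v. f v * g v)"
proof (induction rule: form.induct)
  case (form_linear_mult l d f)
  then show ?case using form.form_linear_mult[of l "d+e"] by (simp add: mult.assoc)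
qed (auto simp: distrib_right form_scale intro: form.intros)

lemma form_power: "form d f \<Longrightarrow> form (n * d) (\<lambda>v. f v ^ n)"
  by (induction n) (auto intro: form_mult simp: form_const)

lemma form_zero: "form d (\<lambda>v. 0)"
  by (induction d) (use form_const form_linear_mult[of "\<lambda>v. 0"] in \<open>auto simp: linear_iff\<close>)

lemma form_sum: "finite I \<Longrightarrow> (\<And>i. i \<in> I \<Longrightarrow> form d (f i)) \<Longrightarrow> form d (\<lambda>v. \<Sum>i\<in>I. f i v)"
  by (induction I rule: finite_induct) (auto intro: form_add form_zero)

lemma form_prod: "finite I \<Longrightarrow> (\<And>i. i \<in> I \<Longrightarrow> form (d i) (f i)) \<Longrightarrow>
    form (\<Sum>i\<in>I. d i) (\<lambda>v. \<Prod>i\<in>I. f i v)"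
  by (induction I rule: finite_induct) (auto intro: form_mult simp: form_const)

lemma form_compose_linear: "form d f \<Longrightarrow> linear T \<Longrightarrow> form d (\<lambda>v. f (T v))"
proof (induction rule: form.induct)
  case (form_linear_mult l d f)
  then show ?case
    using form.form_linear_mult[of "\<lambda>v. l (T v)"] linear_compose[of T l] by (auto simp: o_def)
qed (auto intro: form.intros)

lemma form_homogeneous: "form d f \<Longrightarrow> f (t *\<^sub>R v) = t ^ d * f v"
  by (induction rule: form.induct) (auto simp: linear_scale algebra_simps)

lemma form_continuous: "form d f \<Longrightarrow> continuous_on UNIV (f :: 'a::euclidean_space \<Rightarrow> real)"
  by (induction rule: form.induct)
     (auto intro!: continuous_intros simp: linear_continuous_on linear_conv_bounded_linear)

lemma linear_functional_3:
  assumes "linear (l :: real^3 \<Rightarrow> real)"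
  shows "l v = l (axis 1 1) * v$1 + l (axis 2 1) * v$2 + l (axis 3 1) * v$3"
proof -
  have "v = v$1 *\<^sub>R axis 1 1 + v$2 *\<^sub>R axis 2 1 + v$3 *\<^sub>R axis 3 1"
    by (simp add: Finite_Cartesian_Product.vec_eq_iff forall_3 axis_def)
  then have "l v = l (v$1 *\<^sub>R axis 1 1 + v$2 *\<^sub>R axis 2 1 + v$3 *\<^sub>R axis 3 1)" by simp
  also have "\<dots> = l (axis 1 1) * v$1 + l (axis 2 1) * v$2 + l (axis 3 1) * v$3"
    using assms by (simp add: linear_add linear_scale)
  finally show ?thesis .
qed

text \<open>Coefficient lists for forms of degree one to four in the coordinates \<open>x, y, z\<close>. The monomials of
  \<open>conic\<close> come in the order of the rows of the Hankel matrix; those of \<open>cubic\<close> and \<open>quartic\<close> are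
  grouped by powers of \<open>x\<close>, since the zero to be analysed is moved to the first axis.\<close>

definition line3 :: "(nat \<Rightarrow> real) \<Rightarrow> real^3 \<Rightarrow> real" where
  "line3 k v = k 0 * v$1 + k 1 * v$2 + k 2 * v$3"

definition conic :: "(nat \<Rightarrow> real) \<Rightarrow> real^3 \<Rightarrow> real" where
  "conic k v = k 0 * v$1^2 + k 1 * v$2^2 + k 2 * v$3^2
    + k 3 * (v$1 * v$2) + k 4 * (v$1 * v$3) + k 5 * (v$2 * v$3)"

definition cubic :: "(nat \<Rightarrow> real) \<Rightarrow> real^3 \<Rightarrow> real" where
  "cubic k v = k 0 * v$1^3
    + v$1^2 * (k 1 * v$2 + k 2 * v$3)
    + v$1 * (k 3 * v$2^2 + k 4 * (v$2 * v$3) + k 5 * v$3^2)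
    + (k 6 * v$2^3 + k 7 * (v$2^2 * v$3) + k 8 * (v$2 * v$3^2) + k 9 * v$3^3)"

definition quartic :: "(nat \<Rightarrow> real) \<Rightarrow> real^3 \<Rightarrow> real" where
  "quartic k v = k 0 * v$1^4
    + v$1^3 * (k 1 * v$2 + k 2 * v$3)
    + v$1^2 * (k 3 * v$2^2 + k 4 * (v$2 * v$3) + k 5 * v$3^2)
    + v$1 * (k 6 * v$2^3 + k 7 * (v$2^2 * v$3) + k 8 * (v$2 * v$3^2) + k 9 * v$3^3)
    + (k 10 * v$2^4 + k 11 * (v$2^3 * v$3) + k 12 * (v$2^2 * v$3^2) + k 13 * (v$2 * v$3^3)
       + k 14 * v$3^4)"

lemma form_0_coeffs: "form d f \<Longrightarrow> d = 0 \<Longrightarrow> \<exists>c. f = (\<lambda>v. c)"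
  by (induction rule: form.induct) auto

lemma linear_eq_line3: "linear l \<Longrightarrow> \<exists>k. l = line3 k"
  by (intro exI[of _ "(!) [l (axis 1 1), l (axis 2 1), l (axis 3 1)]"] ext, subst linear_functional_3)
     (simp_all add: line3_def)

lemma form_1_coeffs: "form d f \<Longrightarrow> d = 1 \<Longrightarrow> \<exists>k. f = line3 k"
proof (induction rule: form.induct)
  case (form_linear_mult l d f)
  have "d = 0" using form_linear_mult.prems by simp
  with form_0_coeffs[OF form_linear_mult.hyps(2)] obtain k where f: "f = (\<lambda>v. k)"
    by blast
  obtain m where l: "l = line3 m"
    using linear_eq_line3[OF form_linear_mult.hyps(1)] by blast
  show ?case unfolding f l
    by (rule exI[of _ "\<lambda>i. m i * k"]) (simp add: line3_def fun_eq_iff algebra_simps)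
next
  case (form_add d f g)
  obtain k m where "f = line3 k" "g = line3 m"
    using form_add.IH[OF form_add.prems] by blast
  then show ?case
    by (intro exI[of _ "\<lambda>i. k i + m i"]) (simp add: line3_def fun_eq_iff algebra_simps)
qed auto

lemma line3_times_line3: "line3 l v * line3 k v = conic ((!) [l 0 * k 0, l 1 * k 1, l 2 * k 2,
    l 0 * k 1 + l 1 * k 0, l 0 * k 2 + l 2 * k 0, l 1 * k 2 + l 2 * k 1]) v"
  by (simp add: line3_def conic_def algebra_simps power2_eq_square power3_eq_cube power4_eq_xxxx)

lemma form_2_coeffs: "form d f \<Longrightarrow> d = 2 \<Longrightarrow> \<exists>k. f = conic k"
proof (induction rule: form.induct)
  case (form_linear_mult l d f)
  have "d = 1" using form_linear_mult.prems by simp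
  with form_1_coeffs[OF form_linear_mult.hyps(2)] obtain k where f: "f = line3 k"
    by blast
  obtain m where l: "l = line3 m"
    using linear_eq_line3[OF form_linear_mult.hyps(1)] by blast
  show ?case unfolding f l using line3_times_line3 by blast
next
  case (form_add d f g)
  obtain k m where "f = conic k" "g = conic m"
    using form_add.IH[OF form_add.prems] by blast
  then show ?case
    by (intro exI[of _ "\<lambda>i. k i + m i"]) (simp add: conic_def fun_eq_iff algebra_simps)
qed auto

lemma line3_times_conic: "line3 l v * conic k v = cubic ((!) [l 0 * k 0, l 0 * k 3 + l 1 * k 0, l 0 * k 4 + l 2 * k 0,
    l 0 * k 1 + l 1 * k 3, l 0 * k 5 + l 1 * k 4 + l 2 * k 3, l 0 * k 2 + l 2 * k 4,
    l 1 * k 1, l 1 * k 5 + l 2 * k 1, l 1 * k 2 + l 2 * k 5, l 2 * k 2]) v"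
  by (simp add: line3_def conic_def cubic_def algebra_simps power2_eq_square power3_eq_cube power4_eq_xxxx)

lemma form_3_coeffs: "form d f \<Longrightarrow> d = 3 \<Longrightarrow> \<exists>k. f = cubic k"
proof (induction rule: form.induct)
  case (form_linear_mult l d f)
  have "d = 2" using form_linear_mult.prems by simp
  with form_2_coeffs[OF form_linear_mult.hyps(2)] obtain k where f: "f = conic k"
    by blast
  obtain m where l: "l = line3 m"
    using linear_eq_line3[OF form_linear_mult.hyps(1)] by blast
  show ?case unfolding f l using line3_times_conic by blast
next
  case (form_add d f g)
  obtain k m where "f = cubic k" "g = cubic m"
    using form_add.IH[OF form_add.prems] by blast
  then show ?case
    by (intro exI[of _ "\<lambda>i. k i + m i"]) (simp add: cubic_def fun_eq_iff algebra_simps)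
qed auto

lemma line3_times_cubic: "line3 l v * cubic k v = quartic ((!) [l 0 * k 0, l 0 * k 1 + l 1 * k 0, l 0 * k 2 + l 2 * k 0,
    l 0 * k 3 + l 1 * k 1, l 0 * k 4 + l 1 * k 2 + l 2 * k 1, l 0 * k 5 + l 2 * k 2,
    l 0 * k 6 + l 1 * k 3, l 0 * k 7 + l 1 * k 4 + l 2 * k 3, l 0 * k 8 + l 1 * k 5 + l 2 * k 4,
    l 0 * k 9 + l 2 * k 5,
    l 1 * k 6, l 1 * k 7 + l 2 * k 6, l 1 * k 8 + l 2 * k 7, l 1 * k 9 + l 2 * k 8, l 2 * k 9]) v"
  by (simp add: line3_def cubic_def quartic_def algebra_simps power2_eq_square power3_eq_cube power4_eq_xxxx)

lemma form_4_coeffs: "form d f \<Longrightarrow> d = 4 \<Longrightarrow> \<exists>k. f = quartic k"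
proof (induction rule: form.induct)
  case (form_linear_mult l d f)
  have "d = 3" using form_linear_mult.prems by simp
  with form_3_coeffs[OF form_linear_mult.hyps(2)] obtain k where f: "f = cubic k"
    by blast
  obtain m where l: "l = line3 m"
    using linear_eq_line3[OF form_linear_mult.hyps(1)] by blast
  show ?case unfolding f l using line3_times_cubic by blast
next
  case (form_add d f g)
  obtain k m where "f = quartic k" "g = quartic m"
    using form_add.IH[OF form_add.prems] by blast
  then show ?case
    by (intro exI[of _ "\<lambda>i. k i + m i"]) (simp add: quartic_def fun_eq_iff algebra_simps)
qed auto

section \<open>Nonnegative binary forms\<close>

lemma nonneg_quadratic:
  fixes a b c :: real
  assumes "\<And>x. 0 \<le> a * x^2 + 2 * b * x + c"
  shows "0 \<le> a" "0 \<le> c" "b^2 \<le> a * c"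
proof -
  show c: "0 \<le> c" using assms[of 0] by simp
  show a: "0 \<le> a"
  proof (rule ccontr)
    assume "\<not> 0 \<le> a"
    then have n: "a < 0" by simp
    \<comment> \<open>Adding the values at \<open>x\<close> and \<open>- x\<close> cancels the linear term and leaves \<open>2 (a x\<^sup>2 + c) = - 2\<close>.\<close>
    define x where "x = sqrt ((c + 1) / (- a))"
    have "x^2 = (c + 1) / (- a)" unfolding x_def using n c by (simp add: divide_simps)
    then have "a * x^2 = - (c + 1)" using n by (simp add: field_simps)
    then show False using assms[of x] assms[of "-x"] by simp
  qed
  show "b^2 \<le> a * c"
  proof (cases "a = 0")
    case True
    have "b = 0"
    proof (rule ccontr)
      assume "b \<noteq> 0"
      then show False using assms[of "- (c + 1) / (2 * b)"] True by simp
    qed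
    with True show ?thesis by simp
  next
    case False
    with a have "a > 0" by simp
    moreover have "a * (- b / a)^2 + 2 * b * (- b / a) + c = (a * c - b^2) / a"
      using False by (simp add: field_simps power2_eq_square)
    ultimately show ?thesis using assms[of "- b / a"] by (simp add: zero_le_divide_iff)
  qed
qed

lemma nonneg_at_limit:
  fixes \<phi> :: "real \<Rightarrow> real"
  assumes "continuous_on UNIV \<phi>" and "\<And>t. t \<noteq> 0 \<Longrightarrow> 0 \<le> \<phi> t"
  shows "0 \<le> \<phi> 0"
proof (rule tendsto_lowerbound)
  show "(\<phi> \<longlongrightarrow> \<phi> 0) (at 0)"
    using assms(1) by (simp add: continuous_on_def)
  show "\<forall>\<^sub>F t in at 0. 0 \<le> \<phi> t"
    using assms(2) by (auto simp: eventually_at_filter)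
qed simp

text \<open>A nonnegative polynomial that vanishes at the origin has derivative zero there. It is seen from the
  sign of the quotient by \<open>t\<close> on both sides of the origin.\<close>

lemma linear_coeff_zero:
  fixes a b c d :: real
  assumes "\<And>t. 0 \<le> t * (a + b * t + c * t^2 + d * t^3)"
  shows "a = 0"
proof -
  have "0 \<le> (\<lambda>t. a + b * \<bar>t\<bar> + c * t^2 + d * \<bar>t\<bar>^3) 0"
  proof (rule nonneg_at_limit)
    fix t :: real assume "t \<noteq> 0"
    then show "0 \<le> a + b * \<bar>t\<bar> + c * t^2 + d * \<bar>t\<bar>^3"
      using assms[of "\<bar>t\<bar>"] by (simp add: zero_le_mult_iff)
  qed (intro continuous_intros)
  moreover have "0 \<le> (\<lambda>t. - a + b * \<bar>t\<bar> - c * t^2 + d * \<bar>t\<bar>^3) 0"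
  proof (rule nonneg_at_limit)
    fix t :: real assume "t \<noteq> 0"
    then show "0 \<le> - a + b * \<bar>t\<bar> - c * t^2 + d * \<bar>t\<bar>^3"
      using assms[of "- \<bar>t\<bar>"] by (simp add: mult_le_0_iff)
  qed (intro continuous_intros)
  ultimately show ?thesis by simp
qed

text \<open>By continuity, nonnegativity off a line through the origin extends to the line: move from a point
  of the line \<open>p y + r z = 0\<close> along its normal \<open>(p, r)\<close>. This is used after dividing an inequality
  by \<open>p y + r z\<close>.\<close>

lemma nonneg_off_line:
  fixes K :: "real \<Rightarrow> real \<Rightarrow> real"
  assumes "p \<noteq> 0 \<or> r \<noteq> 0"
    and "\<And>a b c d. continuous_on UNIV (\<lambda>t. K (a + b * t) (c + d * t))"
    and "\<And>y z. p * y + r * z \<noteq> 0 \<Longrightarrow> 0 \<le> K y z"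
  shows "0 \<le> K y z"
proof (cases "p * y + r * z = 0")
  case True
  have "0 \<le> (\<lambda>t. K (y + p * t) (z + r * t)) 0"
  proof (rule nonneg_at_limit)
    fix t :: real assume "t \<noteq> 0"
    have "p * (y + p * t) + r * (z + r * t) = t * (p^2 + r^2)"
      using True by (simp add: algebra_simps power2_eq_square)
    also have "\<dots> \<noteq> 0" using \<open>t \<noteq> 0\<close> assms(1) by (simp add: sum_power2_eq_zero_iff)
    finally show "0 \<le> K (y + p * t) (z + r * t)" by (rule assms(3))
  qed (rule assms(2))
  then show ?thesis by simp
qed (rule assms(3))

text \<open>The middle coefficient is doubled so that nonnegativity gives \<open>b\<^sup>2 \<le> a * c\<close> without factors.\<close>

definition bquad :: "real \<Rightarrow> real \<Rightarrow> real \<Rightarrow> real \<Rightarrow> real \<Rightarrow> real" where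
  "bquad a b c y z = a * y^2 + 2 * b * (y * z) + c * z^2"

lemma bquad_zero [simp]: "bquad a b c 0 0 = 0" by (simp add: bquad_def)

lemma bquad_coeffs:
  assumes "\<And>y z. 0 \<le> bquad a b c y z"
  shows "0 \<le> a" "0 \<le> c" "b^2 \<le> a * c"
  using nonneg_quadratic[of a b c] assms[of _ 1] by (simp_all add: bquad_def algebra_simps)

lemma bquad_two_squares:
  assumes "\<And>y z. 0 \<le> bquad a b c y z"
  shows "\<exists>p r s. \<forall>y z. bquad a b c y z = (p * y + r * z)^2 + (s * z)^2"
proof (cases "a = 0")
  case True
  then have "b = 0" using bquad_coeffs[OF assms] by simp
  with True bquad_coeffs(2)[OF assms] show ?thesis
    by (intro exI[of _ 0] exI[of _ "sqrt c"]) (simp add: bquad_def power_mult_distrib)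
next
  case False
  then have a: "a > 0" using bquad_coeffs(1)[OF assms] by simp
  define p where "p = sqrt a"
  have p: "p \<noteq> 0" "p^2 = a" using a by (auto simp: p_def)
  have "0 \<le> c - b^2 / a" using a bquad_coeffs(3)[OF assms] by (simp add: field_simps)
  then obtain s where s: "s^2 = c - b^2 / a" by (metis real_sqrt_pow2)
  then have c: "c = s^2 + b^2 / p^2" using p(2) by simp
  have "bquad a b c y z = (p * y + b / p * z)^2 + (s * z)^2" for y z
    unfolding bquad_def c p(2)[symmetric] using p(1)
    by (simp add: field_simps power2_eq_square)
  then show ?thesis by blast
qed

text \<open>A zero forces one of the two squares to be redundant: either the second coefficient vanishes, or both
  squares are multiples of \<open>z\<^sup>2\<close>.\<close>

lemma bquad_square_if_zero:
  assumes "\<And>y z. 0 \<le> bquad a b c y z"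
    and "bquad a b c y0 z0 = 0" "y0 \<noteq> 0 \<or> z0 \<noteq> 0"
  shows "\<exists>p r. \<forall>y z. bquad a b c y z = (p * y + r * z)^2"
proof -
  obtain p r s where e: "\<And>y z. bquad a b c y z = (p * y + r * z)^2 + (s * z)^2"
    using bquad_two_squares[OF assms(1)] by blast
  have z: "p * y0 + r * z0 = 0" "s * z0 = 0"
    using e[of y0 z0] assms(2) by (simp_all add: sum_power2_eq_zero_iff)
  show ?thesis
  proof (cases "s = 0")
    case True
    then show ?thesis using e by (intro exI[of _ p] exI[of _ r]) simp
  next
    case False
    with z assms(3) have p: "p = 0" by auto
    have "bquad a b c y z = (0 * y + sqrt (r^2 + s^2) * z)^2" for y z
      by (simp add: e p power_mult_distrib distrib_right)
    then show ?thesis by blast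
  qed
qed

text \<open>The zero set of \<open>p y + r z\<close> is spanned by \<open>(- r, p)\<close>; the vanishing of the form there is exactly
  the statement that the remainder of the division is zero. The same holds for cubics.\<close>

lemma bquad_factor:
  assumes "p \<noteq> 0 \<or> r \<noteq> 0" and z: "\<And>y z. p * y + r * z = 0 \<Longrightarrow> bquad a b c y z = 0"
  shows "\<exists>e f. \<forall>y z. bquad a b c y z = (p * y + r * z) * (e * y + f * z)"
proof (cases "p = 0")
  case True
  then have "r \<noteq> 0" using assms(1) by simp
  moreover have "a = 0" using z[of 1 0] True by (simp add: bquad_def)
  ultimately show ?thesis using True
    by (intro exI[of _ "2 * b / r"] exI[of _ "c / r"])
       (simp add: bquad_def field_simps power2_eq_square)
next
  case False
  define f where "f = (2 * b - r * a / p) / p"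
  have "a * r^2 - 2 * b * (r * p) + c * p^2 = 0"
    using z[of "- r" p] by (simp add: bquad_def algebra_simps)
  then have c: "c = r * f" unfolding f_def using False
    by (simp add: field_simps power2_eq_square) 
  have b: "2 * b = p * f + r * a / p" unfolding f_def using False by (simp add: field_simps)
  have "bquad a b c y z = (p * y + r * z) * (a / p * y + f * z)" for y z
    unfolding bquad_def b c using False by (simp add: field_simps power2_eq_square)
  then show ?thesis by blast
qed

definition bcubic :: "real \<Rightarrow> real \<Rightarrow> real \<Rightarrow> real \<Rightarrow> real \<Rightarrow> real \<Rightarrow> real" where
  "bcubic a b c d y z = a * y^3 + b * (y^2 * z) + c * (y * z^2) + d * z^3"

definition bquartic :: "real \<Rightarrow> real \<Rightarrow> real \<Rightarrow> real \<Rightarrow> real \<Rightarrow> real \<Rightarrow> real \<Rightarrow> real" where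
  "bquartic a b c d e y z =
     a * y^4 + b * (y^3 * z) + c * (y^2 * z^2) + d * (y * z^3) + e * z^4"

lemma continuous_on_binary_forms [continuous_intros]:
  fixes f g :: "'a::topological_space \<Rightarrow> real"
  assumes "continuous_on S f" "continuous_on S g"
  shows "continuous_on S (\<lambda>x. bquad a b c (f x) (g x))"
    and "continuous_on S (\<lambda>x. bcubic a b c d (f x) (g x))"
    and "continuous_on S (\<lambda>x. bquartic a b c d e (f x) (g x))"
  unfolding bquad_def bcubic_def bquartic_def by (intro continuous_intros assms)+

lemma binary_forms_scale:
  "bquad a b c (t * y) (t * z) = t^2 * bquad a b c y z"
  "bcubic a b c d (t * y) (t * z) = t^3 * bcubic a b c d y z"
  "bquartic a b c d e (t * y) (t * z) = t^4 * bquartic a b c d e y z"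
  by (simp_all add: bquad_def bcubic_def bquartic_def algebra_simps
      power2_eq_square power3_eq_cube power4_eq_xxxx)

lemma bcubic_factor:
  assumes "p \<noteq> 0 \<or> r \<noteq> 0" and z: "\<And>y z. p * y + r * z = 0 \<Longrightarrow> bcubic a b c d y z = 0"
  shows "\<exists>e f g. \<forall>y z. bcubic a b c d y z = (p * y + r * z) * bquad e f g y z"
proof (cases "p = 0")
  case True
  then have "r \<noteq> 0" using assms(1) by simp
  moreover have "a = 0" using z[of 1 0] True by (simp add: bcubic_def)
  ultimately show ?thesis using True
    by (intro exI[of _ "b / r"] exI[of _ "c / (2 * r)"] exI[of _ "d / r"])
       (simp add: bquad_def bcubic_def field_simps power2_eq_square power3_eq_cube)
next
  case False
  define e where "e = a / p"
  define f where "f = (b - r * e) / p"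
  define g where "g = (c - r * f) / p"
  have 1: "a = p * e" "b = p * f + r * e" "c = p * g + r * f"
    unfolding e_def f_def g_def using False by simp_all
  have "p^3 * (d - r * g) = 0"
    using z[of "- r" p] unfolding 1 by (simp add: bcubic_def algebra_simps power2_eq_square power3_eq_cube)
  then have d: "d = r * g" using False by simp
  have "bcubic a b c d y z = (p * y + r * z) * bquad e (f / 2) g y z" for y z
    unfolding bquad_def bcubic_def 1 d by (simp add: algebra_simps power2_eq_square power3_eq_cube)
  then show ?thesis by blast
qed

text \<open>The quotient of two positive forms of the same degree is constant on rays, so it attains its
  minimum, which is positive, on the unit sphere.\<close>

lemma homogeneous_bound:
  fixes P Q :: "'a::euclidean_space \<Rightarrow> real"
  assumes cont: "continuous_on UNIV P" "continuous_on UNIV Q"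
    and hom: "\<And>t v. P (t *\<^sub>R v) = t ^ d * P v" "\<And>t v. Q (t *\<^sub>R v) = t ^ d * Q v"
    and pos: "\<And>v. v \<noteq> 0 \<Longrightarrow> 0 < P v" "\<And>v. v \<noteq> 0 \<Longrightarrow> 0 < Q v"
  shows "\<exists>\<mu>>0. \<forall>v. v \<noteq> 0 \<longrightarrow> \<mu> * Q v \<le> P v"
proof -
  let ?S = "sphere (0::'a) 1"
  have ne: "v \<noteq> 0" if "v \<in> ?S" for v :: 'a using that by auto
  have Q0: "Q v \<noteq> 0" if "v \<in> ?S" for v using pos(2)[OF ne[OF that]] by simp
  have "continuous_on ?S (\<lambda>v. P v / Q v)"
    by (intro continuous_intros continuous_on_subset[OF cont(1)] continuous_on_subset[OF cont(2)])
       (auto simp: Q0)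
  moreover have "?S \<noteq> {}" by simp
  ultimately obtain u where u: "u \<in> ?S" "\<And>v. v \<in> ?S \<Longrightarrow> P u / Q u \<le> P v / Q v"
    using continuous_attains_inf[of ?S "\<lambda>v. P v / Q v"] by auto
  define \<mu> where "\<mu> = P u / Q u"
  have "0 < \<mu>" unfolding \<mu>_def using pos ne[OF u(1)] by simp
  moreover have "\<mu> * Q v \<le> P v" if "v \<noteq> 0" for v
  proof -
    define w where "w = (1 / norm v) *\<^sub>R v"
    have w: "w \<in> ?S" "v = norm v *\<^sub>R w" using that by (auto simp: w_def)
    have "\<mu> * Q w \<le> P w"
      using u(2)[OF w(1)] pos(2)[OF ne[OF w(1)]] by (simp add: \<mu>_def field_simps)
    then have "norm v ^ d * (\<mu> * Q w) \<le> norm v ^ d * P w"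
      by (intro mult_left_mono) auto
    then show ?thesis using hom[of "norm v" w] w(2) by (simp add: mult.left_commute)
  qed
  ultimately show ?thesis by blast
qed

lemma binary_bound:
  fixes P Q :: "real \<Rightarrow> real \<Rightarrow> real"
  assumes "continuous_on UNIV (\<lambda>w::real \<times> real. P (fst w) (snd w))"
    "continuous_on UNIV (\<lambda>w::real \<times> real. Q (fst w) (snd w))"
    and "\<And>t y z. P (t * y) (t * z) = t ^ d * P y z" "\<And>t y z. Q (t * y) (t * z) = t ^ d * Q y z"
    and "\<And>y z. y \<noteq> 0 \<or> z \<noteq> 0 \<Longrightarrow> 0 < P y z" "\<And>y z. y \<noteq> 0 \<or> z \<noteq> 0 \<Longrightarrow> 0 < Q y z"
  shows "\<exists>\<mu>>0. \<forall>y z. y \<noteq> 0 \<or> z \<noteq> 0 \<longrightarrow> \<mu> * Q y z \<le> P y z"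
  using homogeneous_bound[OF assms(1,2), of d] assms(3-6)
  by (auto simp: zero_prod_def)

section \<open>Ternary quartics that dominate a square\<close>

text \<open>The property of Choi and Lam: a nonzero square of a quadratic form can be subtracted from \<open>F\<close>
  without losing nonnegativity.\<close>

definition dominates_square :: "('a::real_vector \<Rightarrow> real) \<Rightarrow> bool" where
  "dominates_square F \<longleftrightarrow> (\<exists>q. form 2 q \<and> (\<exists>v. q v \<noteq> 0) \<and> (\<forall>v. (q v)^2 \<le> F v))"

lemma dominates_square_transfer:
  assumes "dominates_square (\<lambda>v. F (T v))" "linear (T :: 'a::euclidean_space \<Rightarrow> 'a)" "inj T"
  shows "dominates_square F"
proof -
  obtain S where S: "linear S" "\<And>v. T (S v) = v" "\<And>v. S (T v) = v"
    using linear_injective_isomorphism[OF assms(2,3)] by blast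
  obtain q where q: "form 2 q" "\<exists>v. q v \<noteq> 0" "\<And>v. (q v)^2 \<le> F (T v)"
    using assms(1) by (auto simp: dominates_square_def)
  obtain w where "q w \<noteq> 0" using q(2) by blast
  then have "q (S (T w)) \<noteq> 0" using S(3) by simp
  moreover have "(q (S v))^2 \<le> F v" for v using q(3)[of "S v"] S(2) by simp
  ultimately show ?thesis unfolding dominates_square_def
    using form_compose_linear[OF q(1) S(1)] by blast
qed

lemma sum_of_squares_dominates:
  assumes "form 2 q1" "form 2 q2" "form 2 q3" "\<And>v. F v = (q1 v)^2 + (q2 v)^2 + (q3 v)^2" "F w \<noteq> 0"
  shows "dominates_square F"
proof -
  have "q1 w \<noteq> 0 \<or> q2 w \<noteq> 0 \<or> q3 w \<noteq> 0" using assms(4,5) by auto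
  moreover have "(q1 v)^2 \<le> F v" "(q2 v)^2 \<le> F v" "(q3 v)^2 \<le> F v" for v
    using assms(4)[of v] by simp_all
  ultimately show ?thesis using assms(1-3) unfolding dominates_square_def by blast
qed

lemma form_1_yz: "form 1 (\<lambda>v::real^3. a * v$2 + b * v$3)"
  by (intro form_add form_scale form_nth)

lemma form_2_mult: "form 1 f \<Longrightarrow> form 1 g \<Longrightarrow> form 2 (\<lambda>v. f v * g v)"
  using form_mult[of 1 f 1 g] by (simp add: numeral_2_eq_2)

lemma form_2_bquad: "form 2 (\<lambda>v::real^3. bquad a b c (v$2) (v$3))"
  unfolding bquad_def power2_eq_square
  by (intro form_add form_scale form_2_mult form_nth)

text \<open>If \<open>g\<^sup>2 \<le> m\<^sup>2 h\<close> for a linear form \<open>m\<close>, then \<open>g\<close> vanishes where \<open>m\<close> does, hence \<open>g = m e\<close>, and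
  cancelling \<open>m\<^sup>2\<close> leaves \<open>e\<^sup>2 \<le> h\<close>. For \<open>m = 0\<close> the choice \<open>e = 0\<close> works.\<close>

lemma bquad_divide:
  assumes h: "\<And>y z. 0 \<le> bquad h0 h1 h2 y z"
    and gh: "\<And>y z. (bquad g0 g1 g2 y z)^2 \<le> (p * y + r * z)^2 * bquad h0 h1 h2 y z"
  shows "\<exists>a b. \<forall>y z. bquad g0 g1 g2 y z = (p * y + r * z) * (a * y + b * z) \<and>
                    (a * y + b * z)^2 \<le> bquad h0 h1 h2 y z"
proof (cases "p = 0 \<and> r = 0")
  case True
  then show ?thesis using gh h by (intro exI[of _ 0]) simp
next
  case False
  then have pr: "p \<noteq> 0 \<or> r \<noteq> 0" by simp
  have "bquad g0 g1 g2 y z = 0" if "p * y + r * z = 0" for y z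
    using gh[of y z] that by simp
  then obtain a b where g: "\<And>y z. bquad g0 g1 g2 y z = (p * y + r * z) * (a * y + b * z)"
    using bquad_factor[OF pr] by metis
  have "0 \<le> bquad h0 h1 h2 y z - (a * y + b * z)^2" for y z
  proof (rule nonneg_off_line[OF pr, where K = "\<lambda>y z. bquad h0 h1 h2 y z - (a * y + b * z)^2"])
    fix y z assume "p * y + r * z \<noteq> 0"
    then show "0 \<le> bquad h0 h1 h2 y z - (a * y + b * z)^2"
      using gh[of y z] by (simp add: g power_mult_distrib)
  qed (intro continuous_intros)
  then show ?thesis using g by (intro exI[of _ a] exI[of _ b]) auto
qed

text \<open>A quadratic polynomial \<open>X\<^sup>2 f + 2 X Z g + Z\<^sup>2 h\<close> with positive semidefinite coefficient matrix over the
  binary forms is a sum of squares as soon as \<open>f\<close> has a zero: then \<open>f = m\<^sup>2\<close>, the off-diagonal entry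
  is \<open>g = m e\<close>, and completing the square leaves \<open>Z\<^sup>2 (h - e\<^sup>2)\<close>, where \<open>h - e\<^sup>2\<close> is a nonnegative
  binary quadratic form and so a sum of two squares. Leaving \<open>X\<close> and \<open>Z\<close> arbitrary makes the lemma
  apply with the two roles exchanged and after a shear.\<close>

lemma degenerate_pencil:
  assumes "form 1 X" "form 1 Z"
    and F: "\<And>v::real^3. F v = (X v)^2 * bquad f0 f1 f2 (v$2) (v$3)
       + 2 * (X v * Z v) * bquad g0 g1 g2 (v$2) (v$3) + (Z v)^2 * bquad h0 h1 h2 (v$2) (v$3)"
    and f: "\<And>y z. 0 \<le> bquad f0 f1 f2 y z" and h: "\<And>y z. 0 \<le> bquad h0 h1 h2 y z"
    and gh: "\<And>y z. (bquad g0 g1 g2 y z)^2 \<le> bquad f0 f1 f2 y z * bquad h0 h1 h2 y z"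
    and zero: "bquad f0 f1 f2 y0 z0 = 0" "y0 \<noteq> 0 \<or> z0 \<noteq> 0"
    and "F w \<noteq> 0"
  shows "dominates_square F"
proof -
  obtain p r where f': "\<And>y z. bquad f0 f1 f2 y z = (p * y + r * z)^2"
    using bquad_square_if_zero[OF f zero] by blast
  obtain a b where g': "\<And>y z. bquad g0 g1 g2 y z = (p * y + r * z) * (a * y + b * z)"
    and hab: "\<And>y z. (a * y + b * z)^2 \<le> bquad h0 h1 h2 y z"
    using bquad_divide[OF h, of g0 g1 g2 p r] gh unfolding f' by blast
  have k: "bquad (h0 - a^2) (h1 - a * b) (h2 - b^2) y z = bquad h0 h1 h2 y z - (a * y + b * z)^2" for y z
    by (simp add: bquad_def algebra_simps power2_eq_square)
  have "0 \<le> bquad (h0 - a^2) (h1 - a * b) (h2 - b^2) y z" for y z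
    using hab[of y z] by (simp add: k)
  from bquad_two_squares[OF this] obtain c d s where
    cds: "\<And>y z. bquad h0 h1 h2 y z - (a * y + b * z)^2 = (c * y + d * z)^2 + (s * z)^2"
    unfolding k by blast
  have h': "bquad h0 h1 h2 y z = (a * y + b * z)^2 + (c * y + d * z)^2 + (s * z)^2" for y z
    using cds[of y z] by simp
  show ?thesis
  proof (rule sum_of_squares_dominates)
    show "form 2 (\<lambda>v. X v * (p * v$2 + r * v$3) + Z v * (a * v$2 + b * v$3))"
      by (intro form_add form_2_mult assms(1,2) form_1_yz)
    show "form 2 (\<lambda>v. Z v * (c * v$2 + d * v$3))"
      by (intro form_2_mult assms(2) form_1_yz)
    show "form 2 (\<lambda>v. Z v * (s * v$3))"
      by (intro form_2_mult assms(2) form_scale form_nth)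
    show "F w \<noteq> 0" by fact
    show "F v = (X v * (p * v$2 + r * v$3) + Z v * (a * v$2 + b * v$3))^2
        + (Z v * (c * v$2 + d * v$3))^2 + (Z v * (s * v$3))^2" for v
      unfolding F f' g' h' by (simp add: algebra_simps power2_eq_square)
  qed
qed

text \<open>For fixed \<open>(y, z)\<close> the polynomial is quadratic in \<open>x\<close>, and the classical criterion gives the
  semidefiniteness of the matrix with entries \<open>f, z g, z\<^sup>2 h\<close>. Dividing by powers of \<open>z\<close> is legitimate
  off the line \<open>z = 0\<close>, and continuity does the rest.\<close>

lemma psd_pencil_at_two_zeros:
  assumes F: "\<And>v::real^3. F v = (v$1)^2 * bquad f0 f1 f2 (v$2) (v$3)
       + 2 * (v$1 * v$3) * bquad g0 g1 g2 (v$2) (v$3) + (v$3)^2 * bquad h0 h1 h2 (v$2) (v$3)"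
    and nn: "\<And>v. 0 \<le> F v"
  shows "0 \<le> bquad f0 f1 f2 y z" "0 \<le> bquad h0 h1 h2 y z"
    and "(bquad g0 g1 g2 y z)^2 \<le> bquad f0 f1 f2 y z * bquad h0 h1 h2 y z"
proof -
  let ?f = "bquad f0 f1 f2" and ?g = "bquad g0 g1 g2" and ?h = "bquad h0 h1 h2"
  have q: "0 \<le> ?f y z * x^2 + 2 * (z * ?g y z) * x + z^2 * ?h y z" for x y z
    using nn[of "vector [x, y, z]"] unfolding F by (simp add: algebra_simps)
  have off: "0 \<le> ?f y z" "0 \<le> ?h y z" "0 \<le> ?f y z * ?h y z - (?g y z)^2" if z: "z \<noteq> 0" for y z
  proof -
    show "0 \<le> ?f y z" using nonneg_quadratic(1)[OF q] .
    show "0 \<le> ?h y z" using nonneg_quadratic(2)[OF q, of z y] z by (simp add: zero_le_mult_iff)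
    have "z^2 * (?g y z)^2 \<le> z^2 * (?f y z * ?h y z)"
      using nonneg_quadratic(3)[OF q, of z y] by (simp add: power_mult_distrib algebra_simps)
    then show "0 \<le> ?f y z * ?h y z - (?g y z)^2" using z by simp
  qed
  show "0 \<le> ?f y z" using nonneg_quadratic(1)[OF q] .
  show "0 \<le> ?h y z"
    by (rule nonneg_off_line[of 0 1 ?h]) (use off(2) in \<open>auto intro!: continuous_intros\<close>)
  have "0 \<le> (\<lambda>y z. ?f y z * ?h y z - (?g y z)^2) y z"
    by (rule nonneg_off_line[of 0 1])
       (use off(3) in \<open>auto intro!: continuous_intros simp del: diff_ge_0_iff_ge\<close>)
  then show "(?g y z)^2 \<le> ?f y z * ?h y z" by simp
qed

text \<open>The shape of \<open>F\<close> is that of a nonnegative quartic with zeros on the first two axes: it has degree two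
  in \<open>x\<close>, and its terms of degree one and zero in \<open>x\<close> are divisible by \<open>z\<close> and \<open>z\<^sup>2\<close>. Three
  cases arise. If \<open>f\<close> has a zero, the pencil is degenerate. If only the
  discriminant \<open>f h - g\<^sup>2\<close> has a zero, a shear of \<open>x\<close> by a multiple of \<open>z\<close> makes the last
  coefficient vanish there, and the pencil is degenerate with the roles of the variables
  exchanged. If the discriminant is positive, compactness bounds it below by a multiple of
  \<open>f (y\<^sup>2 + z\<^sup>2)\<close>, and completing the square gives a multiple of \<open>z\<^sup>4\<close> as a lower bound of \<open>F\<close>.\<close>

lemma dominates_square_two_zeros:
  assumes F: "\<And>v::real^3. F v = (v$1)^2 * bquad f0 f1 f2 (v$2) (v$3)
       + 2 * (v$1 * v$3) * bquad g0 g1 g2 (v$2) (v$3) + (v$3)^2 * bquad h0 h1 h2 (v$2) (v$3)"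
    and nn: "\<And>v. 0 \<le> F v" and w: "F w \<noteq> 0"
  shows "dominates_square F"
proof -
  let ?f = "bquad f0 f1 f2" and ?g = "bquad g0 g1 g2" and ?h = "bquad h0 h1 h2"
  note psd = psd_pencil_at_two_zeros[OF F nn]
  show ?thesis
  proof (cases "\<exists>y z. (y \<noteq> 0 \<or> z \<noteq> 0) \<and> ?f y z = 0")
    case True
    then obtain y z where yz: "?f y z = 0" "y \<noteq> 0 \<or> z \<noteq> 0" by blast
    show ?thesis by (rule degenerate_pencil[OF form_nth form_nth F psd yz w])
  next
    case False
    then have fpos: "0 < ?f y z" if "y \<noteq> 0 \<or> z \<noteq> 0" for y z
      using psd(1)[of y z] that by (metis less_eq_real_def)
    show ?thesis
    proof (cases "\<exists>y z. (y \<noteq> 0 \<or> z \<noteq> 0) \<and> ?f y z * ?h y z = (?g y z)^2")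
      case True
      then obtain y0 z0 where yz: "y0 \<noteq> 0 \<or> z0 \<noteq> 0" "?f y0 z0 * ?h y0 z0 = (?g y0 z0)^2"
        by blast
      define s where "s = ?g y0 z0 / ?f y0 z0"
      have g0: "?g y0 z0 = s * ?f y0 z0" using fpos[OF yz(1)] by (simp add: s_def)
      have h0: "?h y0 z0 = s^2 * ?f y0 z0"
        using yz(2) fpos[OF yz(1)] unfolding g0 by (simp add: power2_eq_square)
      \<comment> \<open>The coefficients of the pencil in the variables \<open>z\<close> and \<open>x + s z\<close>; \<open>s\<close> is chosen to make \<open>?k\<close> vanish at \<open>(y0, z0)\<close>.\<close>
      let ?k = "bquad (h0 - 2 * s * g0 + s^2 * f0) (h1 - 2 * s * g1 + s^2 * f1) (h2 - 2 * s * g2 + s^2 * f2)"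
      let ?l = "bquad (g0 - s * f0) (g1 - s * f1) (g2 - s * f2)"
      have k: "?k y z = ?h y z - 2 * s * ?g y z + s^2 * ?f y z" for y z
        by (simp add: bquad_def algebra_simps)
      have l: "?l y z = ?g y z - s * ?f y z" for y z
        by (simp add: bquad_def algebra_simps)
      have disc: "?f y z * ?k y z - (?l y z)^2 = ?f y z * ?h y z - (?g y z)^2" for y z
        unfolding k l by (simp add: algebra_simps power2_eq_square)
      have lk: "(?l y z)^2 \<le> ?k y z * ?f y z" for y z
        using disc[of y z] psd(3)[of y z] by (simp add: mult.commute)
      show ?thesis
      proof (rule degenerate_pencil)
        show "form 1 (\<lambda>v::real^3. v$3)" "form 1 (\<lambda>v::real^3. v$1 + s * v$3)"
          by (intro form_add form_scale form_nth)+
        show "F v = (v$3)^2 * ?k (v$2) (v$3) + 2 * (v$3 * (v$1 + s * v$3)) * ?l (v$2) (v$3)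
            + (v$1 + s * v$3)^2 * ?f (v$2) (v$3)" for v
          unfolding F k l by (simp add: algebra_simps power2_eq_square)
        show "(?l y z)^2 \<le> ?k y z * ?f y z" for y z by (rule lk)
        show "0 \<le> ?k y z" for y z
        proof (cases "y \<noteq> 0 \<or> z \<noteq> 0")
          case True
          have "0 \<le> ?k y z * ?f y z" using lk[of y z] zero_le_power2 order_trans by blast
          then show ?thesis using fpos[OF True] by (simp add: zero_le_mult_iff)
        qed simp
        show "?k y0 z0 = 0" unfolding k g0 h0 by (simp add: power2_eq_square)
      qed (use yz psd w in auto)
    next
      case False
      let ?D = "\<lambda>y z. ?f y z * ?h y z - (?g y z)^2"
      have Dpos: "0 < ?D y z" if "y \<noteq> 0 \<or> z \<noteq> 0" for y z
        using False psd(3)[of y z] that by (metis diff_gt_0_iff_gt less_eq_real_def)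
      have "\<exists>\<mu>>0. \<forall>y z. y \<noteq> 0 \<or> z \<noteq> 0 \<longrightarrow> \<mu> * (?f y z * (y^2 + z^2)) \<le> ?D y z"
      proof (rule binary_bound[where d = 4])
        show "0 < ?f y z * (y^2 + z^2)" if "y \<noteq> 0 \<or> z \<noteq> 0" for y z
          using fpos[OF that] that by (simp add: sum_power2_gt_zero_iff)
        show "?D (t * y) (t * z) = t^4 * ?D y z" for t y z
          by (simp add: binary_forms_scale algebra_simps power2_eq_square power4_eq_xxxx)
        show "?f (t * y) (t * z) * ((t * y)^2 + (t * z)^2) = t^4 * (?f y z * (y^2 + z^2))" for t y z
          by (simp add: binary_forms_scale algebra_simps power2_eq_square power4_eq_xxxx)
      qed (use Dpos in \<open>auto intro!: continuous_intros\<close>)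
      then obtain \<mu> where \<mu>: "\<mu> > 0"
        "\<And>y z. y \<noteq> 0 \<or> z \<noteq> 0 \<Longrightarrow> \<mu> * (?f y z * (y^2 + z^2)) \<le> ?D y z" by blast
      have "(sqrt \<mu> * (v$3 * v$3))^2 \<le> F v" for v
      proof (cases "v$2 \<noteq> 0 \<or> v$3 \<noteq> 0")
        case True
        let ?y = "v$2" and ?z = "v$3"
        have "?f ?y ?z * (\<mu> * ?z^4) \<le> ?z^2 * (\<mu> * (?f ?y ?z * (?y^2 + ?z^2)))"
        proof -
          have "?f ?y ?z * (\<mu> * ?z^4) = ?z^2 * (\<mu> * (?f ?y ?z * ?z^2))"
            by (simp add: power2_eq_square power4_eq_xxxx mult_ac)
          also have "\<dots> \<le> ?z^2 * (\<mu> * (?f ?y ?z * (?y^2 + ?z^2)))"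
            using fpos[OF True] \<mu>(1) by (intro mult_left_mono) auto
          finally show ?thesis .
        qed
        also have "\<dots> \<le> ?z^2 * ?D ?y ?z" using \<mu>(2)[OF True] by (intro mult_left_mono) auto
        also have "\<dots> \<le> (v$1 * ?f ?y ?z + ?z * ?g ?y ?z)^2 + ?z^2 * ?D ?y ?z" by simp
        also have "\<dots> = ?f ?y ?z * F v"
          unfolding F by (simp add: algebra_simps power2_eq_square)
        finally have "\<mu> * ?z^4 \<le> F v" using fpos[OF True] by simp
        moreover have "(sqrt \<mu> * (?z * ?z))^2 = \<mu> * ?z^4"
          using \<mu>(1) by (simp add: power_mult_distrib flip: power_add)
        ultimately show ?thesis by simp
      qed (use nn[of v] in simp)
      moreover have "form 2 (\<lambda>v::real^3. sqrt \<mu> * (v$3 * v$3))"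
        by (intro form_scale form_2_mult form_nth)
      moreover have "sqrt \<mu> * ((axis 3 1::real^3)$3 * (axis 3 1::real^3)$3) \<noteq> 0" using \<mu>(1) by simp
      ultimately show ?thesis unfolding dominates_square_def by blast
    qed
  qed
qed

text \<open>Now \<open>F = x\<^sup>2 f + 2 x g + h\<close> vanishes on the first axis only. If \<open>f = 0\<close>, then \<open>g = 0\<close> and \<open>F = h\<close> is
  a positive binary quartic. If \<open>f\<close> is the square of a linear form \<open>m \<noteq> 0\<close>, then \<open>m\<close> divides \<open>g\<close>, say
  \<open>g = m e\<close>, and \<open>(x m + e)\<^sup>2\<close> lies below \<open>F\<close>. If \<open>f\<close> is positive definite, a zero of the
  discriminant \<open>f h - g\<^sup>2\<close> would give a second zero of \<open>F\<close>; so the discriminant is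
  at least \<open>\<mu> f\<^sup>3\<close>, and \<open>\<mu> f\<^sup>2\<close> lies below \<open>F\<close>.\<close>

lemma dominates_square_one_zero:
  assumes F: "\<And>v::real^3. F v = (v$1)^2 * bquad f0 f1 f2 (v$2) (v$3)
       + 2 * v$1 * bcubic g0 g1 g2 g3 (v$2) (v$3) + bquartic h0 h1 h2 h3 h4 (v$2) (v$3)"
    and nn: "\<And>v. 0 \<le> F v"
    and only: "\<And>v. F v = 0 \<Longrightarrow> v$2 = 0 \<and> v$3 = 0"
  shows "dominates_square F"
proof -
  let ?f = "bquad f0 f1 f2" and ?g = "bcubic g0 g1 g2 g3" and ?h = "bquartic h0 h1 h2 h3 h4"
  have Fv: "F (vector [x, y, z]) = ?f y z * x^2 + 2 * ?g y z * x + ?h y z" for x y z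
    unfolding F by (simp add: algebra_simps)
  have q: "0 \<le> ?f y z * x^2 + 2 * ?g y z * x + ?h y z" for x y z
    using nn[of "vector [x, y, z]"] unfolding Fv .
  note psd = nonneg_quadratic[OF q]
  have hpos: "0 < ?h y z" if "y \<noteq> 0 \<or> z \<noteq> 0" for y z
    using psd(2)[of y z] only[of "vector [0, y, z]"] that unfolding Fv by (auto simp: less_le)
  show ?thesis
  proof (cases "\<exists>y z. (y \<noteq> 0 \<or> z \<noteq> 0) \<and> ?f y z = 0")
    case True
    then obtain y z where "?f y z = 0" "y \<noteq> 0 \<or> z \<noteq> 0" by blast
    then obtain p r where f': "\<And>y z. ?f y z = (p * y + r * z)^2"
      using bquad_square_if_zero[OF psd(1)] by blast
    show ?thesis
    proof (cases "p = 0 \<and> r = 0")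
      case True
      then have f0: "?f y z = 0" for y z by (simp add: f')
      then have g0: "?g y z = 0" for y z using psd(3)[of y z] by simp
      have "\<exists>\<mu>>0. \<forall>y z. y \<noteq> 0 \<or> z \<noteq> 0 \<longrightarrow> \<mu> * (y^2 + z^2)^2 \<le> ?h y z"
      proof (rule binary_bound[where d = 4])
        show "((t * y)^2 + (t * z)^2)^2 = t^4 * (y^2 + z^2)^2" for t y z :: real
          by (simp add: algebra_simps power2_eq_square power4_eq_xxxx)
        show "0 < (y^2 + z^2)^2" if "y \<noteq> 0 \<or> z \<noteq> 0" for y z :: real
          using that sum_power2_gt_zero_iff[of y z] by simp
      qed (use hpos in \<open>auto simp: binary_forms_scale intro!: continuous_intros\<close>)
      then obtain \<mu> where \<mu>: "\<mu> > 0"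
        "\<And>y z. y \<noteq> 0 \<or> z \<noteq> 0 \<Longrightarrow> \<mu> * (y^2 + z^2)^2 \<le> ?h y z" by blast
      have "(sqrt \<mu> * bquad 1 0 1 (v$2) (v$3))^2 \<le> F v" for v
      proof -
        have "F v = ?h (v$2) (v$3)" by (simp add: F f0 g0)
        moreover have "bquad 1 0 1 (v$2) (v$3) = v$2^2 + v$3^2" by (simp add: bquad_def)
        ultimately show ?thesis using \<mu>(1) \<mu>(2)[of "v$2" "v$3"] nn[of v]
          by (cases "v$2 \<noteq> 0 \<or> v$3 \<noteq> 0") (auto simp: power_mult_distrib)
      qed
      moreover have "form 2 (\<lambda>v::real^3. sqrt \<mu> * bquad 1 0 1 (v$2) (v$3))"
        by (intro form_scale form_2_bquad)
      moreover have "sqrt \<mu> * bquad 1 0 1 ((axis 2 1::real^3)$2) ((axis 2 1::real^3)$3) \<noteq> 0"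
        using \<mu>(1) by (simp add: bquad_def axis_def)
      ultimately show ?thesis unfolding dominates_square_def by blast
    next
      case False
      then have pr: "p \<noteq> 0 \<or> r \<noteq> 0" by simp
      have gh: "(?g y z)^2 \<le> (p * y + r * z)^2 * ?h y z" for y z using psd(3)[of y z] by (simp add: f')
      have "?g y z = 0" if "p * y + r * z = 0" for y z using gh[of y z] that by simp
      then obtain a b c where g: "\<And>y z. ?g y z = (p * y + r * z) * bquad a b c y z"
        using bcubic_factor[OF pr] by metis
      have h: "0 \<le> ?h y z - (bquad a b c y z)^2" for y z
      proof (rule nonneg_off_line[OF pr, where K = "\<lambda>y z. ?h y z - (bquad a b c y z)^2"])
        fix y z assume "p * y + r * z \<noteq> 0"
        then show "0 \<le> ?h y z - (bquad a b c y z)^2"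
          using gh[of y z] by (simp add: g power_mult_distrib)
      qed (intro continuous_intros)
      let ?q = "\<lambda>v::real^3. v$1 * (p * v$2 + r * v$3) + bquad a b c (v$2) (v$3)"
      have "(?q v)^2 \<le> F v" for v
      proof -
        have "F v = (?q v)^2 + (?h (v$2) (v$3) - (bquad a b c (v$2) (v$3))^2)"
          unfolding F f' g by (simp add: algebra_simps power2_eq_square)
        then show ?thesis using h[of "v$2" "v$3"] by simp
      qed
      moreover have "form 2 ?q"
        by (intro form_add form_2_mult form_nth form_1_yz form_2_bquad)
      moreover have "\<exists>v. ?q v \<noteq> 0"
      proof (rule ccontr)
        assume "\<not> (\<exists>v. ?q v \<noteq> 0)"
        then have "?q (vector [1, y, z]) = 0" "?q (vector [0, y, z]) = 0" for y z by blast+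
        then have "p * y + r * z = 0" for y z by simp
        from this[of 1 0] this[of 0 1] pr show False by simp
      qed
      ultimately show ?thesis unfolding dominates_square_def by blast
    qed
  next
    case False
    then have fpos: "0 < ?f y z" if "y \<noteq> 0 \<or> z \<noteq> 0" for y z
      using psd(1)[of y z] that by (metis less_eq_real_def)
    let ?D = "\<lambda>y z. ?f y z * ?h y z - (?g y z)^2"
    have Dpos: "0 < ?D y z" if yz: "y \<noteq> 0 \<or> z \<noteq> 0" for y z
    proof -
      \<comment> \<open>The minimiser in \<open>x\<close>; there \<open>F\<close> equals the discriminant divided by \<open>f\<close>.\<close>
      let ?x = "- ?g y z / ?f y z"
      have "F (vector [?x, y, z]) \<noteq> 0" using only[of "vector [?x, y, z]"] yz by auto
      moreover have "?f y z * F (vector [?x, y, z]) = ?D y z"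
        unfolding Fv using fpos[OF yz] by (simp add: field_simps power2_eq_square)
      ultimately have "?D y z \<noteq> 0" using fpos[OF yz] by (metis mult_eq_0_iff less_irrefl)
      then show ?thesis using psd(3)[of y z] by simp
    qed
    have "\<exists>\<mu>>0. \<forall>y z. y \<noteq> 0 \<or> z \<noteq> 0 \<longrightarrow> \<mu> * (?f y z)^3 \<le> ?D y z"
    proof (rule binary_bound[where d = 6])
      show "?D (t * y) (t * z) = t^6 * ?D y z" for t y z
        by (simp add: binary_forms_scale power_mult_distrib algebra_simps flip: power_add power_mult)
      show "(?f (t * y) (t * z))^3 = t^6 * (?f y z)^3" for t y z
        by (simp add: binary_forms_scale power_mult_distrib flip: power_mult)
    qed (use Dpos fpos in \<open>auto intro!: continuous_intros\<close>)
    then obtain \<mu> where \<mu>: "\<mu> > 0"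
      "\<And>y z. y \<noteq> 0 \<or> z \<noteq> 0 \<Longrightarrow> \<mu> * (?f y z)^3 \<le> ?D y z" by blast
    have "(sqrt \<mu> * ?f (v$2) (v$3))^2 \<le> F v" for v
    proof (cases "v$2 \<noteq> 0 \<or> v$3 \<noteq> 0")
      case True
      let ?y = "v$2" and ?z = "v$3"
      have "?f ?y ?z * (\<mu> * (?f ?y ?z)^2) \<le> ?D ?y ?z"
        using \<mu>(2)[OF True] by (simp add: power2_eq_square power3_eq_cube mult.left_commute)
      also have "\<dots> \<le> (v$1 * ?f ?y ?z + ?g ?y ?z)^2 + ?D ?y ?z" by simp
      also have "\<dots> = ?f ?y ?z * F v"
        unfolding F by (simp add: algebra_simps power2_eq_square)
      finally have "\<mu> * (?f ?y ?z)^2 \<le> F v" using fpos[OF True] by simp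
      then show ?thesis using \<mu>(1) by (simp add: power_mult_distrib)
    qed (use nn[of v] in simp)
    moreover have "form 2 (\<lambda>v::real^3. sqrt \<mu> * ?f (v$2) (v$3))"
      by (intro form_scale form_2_bquad)
    moreover have "sqrt \<mu> * ?f ((axis 2 1::real^3)$2) ((axis 2 1::real^3)$3) \<noteq> 0"
      using \<mu>(1) fpos[of 1 0] by (simp add: axis_def)
    ultimately show ?thesis unfolding dominates_square_def by blast
  qed
qed

text \<open>The cross product completes two independent vectors to a basis.\<close>

lemma exists_frame:
  fixes p q :: "real^3"
  assumes ind: "\<And>a b. a *\<^sub>R p + b *\<^sub>R q = 0 \<Longrightarrow> a = 0 \<and> b = 0"
  shows "\<exists>T :: real^3 \<Rightarrow> real^3. linear T \<and> inj T \<and> T (axis 1 1) = p \<and> T (axis 2 1) = q"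
proof -
  let ?n = "cross3 p q"
  let ?T = "\<lambda>v::real^3. v$1 *\<^sub>R p + v$2 *\<^sub>R q + v$3 *\<^sub>R ?n"
  have lin: "linear ?T"
    by (rule linearI) (simp_all add: algebra_simps)
  have n: "?n \<noteq> 0"
  proof
    assume "?n = 0"
    then have "collinear {0, p, q}" by (simp add: cross_eq_0)
    then consider "p = 0" | "q = 0" | c where "q = c *\<^sub>R p"
      unfolding collinear_lemma by blast
    then show False
    proof cases
      case 1 then show False using ind[of 1 0] by simp
    next
      case 2 then show False using ind[of 0 1] by simp
    next
      case 3 then show False using ind[of c "-1"] by simp
    qed
  qed
  have "v = 0" if "?T v = 0" for v
  proof -
    have "0 = inner ?n (?T v)" using that by simp
    also have "\<dots> = v$3 * inner ?n ?n"
      by (simp add: inner_add_right dot_cross_self)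
    finally have "v$3 = 0" using n by simp
    with that ind[of "v$1" "v$2"] have "v$1 = 0" "v$2 = 0" by simp_all
    with \<open>v$3 = 0\<close> show ?thesis by (simp add: Finite_Cartesian_Product.vec_eq_iff forall_3)
  qed
  then have "inj ?T" using linear_injective_0[OF lin] by blast
  moreover have "?T (axis 1 1) = p" "?T (axis 2 1) = q" by (simp_all add: axis_def)
  ultimately show ?thesis using lin by blast
qed

text \<open>A zero of a nonnegative function is a critical point, so the terms of order zero and one in the
  remaining variables vanish.\<close>

lemma quartic_zero_at_axis_1:
  assumes nn: "\<And>v. 0 \<le> quartic k v" and z: "quartic k (axis 1 1) = 0"
  shows "k 0 = 0" "k 1 = 0" "k 2 = 0"
proof -
  show k0: "k 0 = 0" using z by (simp add: quartic_def axis_def)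
  have "0 \<le> t * (k 1 + k 3 * t + k 6 * t^2 + k 10 * t^3)" for t
    using nn[of "vector [1, t, 0]"] k0
    by (simp add: quartic_def algebra_simps power2_eq_square power3_eq_cube power4_eq_xxxx)
  then show "k 1 = 0" by (rule linear_coeff_zero)
  have "0 \<le> t * (k 2 + k 5 * t + k 9 * t^2 + k 14 * t^3)" for t
    using nn[of "vector [1, 0, t]"] k0
    by (simp add: quartic_def algebra_simps power2_eq_square power3_eq_cube power4_eq_xxxx)
  then show "k 2 = 0" by (rule linear_coeff_zero)
qed

lemma quartic_zero_at_axis_2:
  assumes nn: "\<And>v. 0 \<le> quartic k v" and z: "quartic k (axis 2 1) = 0"
  shows "k 10 = 0" "k 6 = 0" "k 11 = 0"
proof -
  show k0: "k 10 = 0" using z by (simp add: quartic_def axis_def)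
  have "0 \<le> t * (k 6 + k 3 * t + k 1 * t^2 + k 0 * t^3)" for t
    using nn[of "vector [t, 1, 0]"] k0
    by (simp add: quartic_def algebra_simps power2_eq_square power3_eq_cube power4_eq_xxxx)
  then show "k 6 = 0" by (rule linear_coeff_zero)
  have "0 \<le> t * (k 11 + k 12 * t + k 13 * t^2 + k 14 * t^3)" for t
    using nn[of "vector [0, 1, t]"] k0
    by (simp add: quartic_def algebra_simps power2_eq_square power3_eq_cube power4_eq_xxxx)
  then show "k 11 = 0" by (rule linear_coeff_zero)
qed

lemma norm_square_3: "(norm (v::real^3))^2 = v$1^2 + v$2^2 + v$3^2"
  by (simp add: power2_norm_eq_inner inner_vec_def sum_3 flip: power2_eq_square)

text \<open>The Choi-Lam form of Hilbert's theorem on ternary quartics. A positive quartic dominates a multiple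
  of the fourth power of the norm. Otherwise a linear substitution moves one zero, or
  two independent ones if they exist, to coordinate axes.\<close>

theorem nonneg_ternary_quartic_dominates_square:
  fixes F :: "real^3 \<Rightarrow> real"
  assumes form: "form 4 F" and nn: "\<And>v. 0 \<le> F v" and w: "F w \<noteq> 0"
  shows "dominates_square F"
proof -
  define ind where "ind p q \<longleftrightarrow> (\<forall>a b. a *\<^sub>R p + b *\<^sub>R q = 0 \<longrightarrow> a = 0 \<and> b = 0)" for p q :: "real^3"
  consider (none) "\<And>v. v \<noteq> 0 \<Longrightarrow> F v \<noteq> 0"
    | (two) p q where "F p = 0" "F q = 0" "ind p q"
    | (one) p where "p \<noteq> 0" "F p = 0" "\<And>q. F q = 0 \<Longrightarrow> \<not> ind p q"
    by blast
  then show ?thesis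
  proof cases
    case none
    have "\<exists>\<mu>>0. \<forall>v. v \<noteq> 0 \<longrightarrow> \<mu> * norm v ^ 4 \<le> F v"
    proof (rule homogeneous_bound[where d = 4])
      show "0 < F v" if "v \<noteq> 0" for v using none[OF that] nn[of v] by simp
    qed (use form_homogeneous[OF form] form_continuous[OF form] in
          \<open>auto simp: power_mult_distrib intro!: continuous_intros\<close>)
    then obtain \<mu> where \<mu>: "\<mu> > 0" "\<And>v. v \<noteq> 0 \<Longrightarrow> \<mu> * norm v ^ 4 \<le> F v" by blast
    let ?q = "\<lambda>v::real^3. sqrt \<mu> * (v$1 * v$1 + v$2 * v$2 + v$3 * v$3)"
    have "(?q v)^2 \<le> F v" for v
    proof -
      have "(?q v)^2 = \<mu> * (norm v ^ 2)^2"
        unfolding norm_square_3 using \<mu>(1) by (simp add: power_mult_distrib power2_eq_square)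
      also have "\<dots> = \<mu> * norm v ^ 4" by simp
      also have "\<dots> \<le> F v" using \<mu>(2)[of v] nn[of v] by (cases "v = 0") auto
      finally show ?thesis .
    qed
    moreover have "form 2 ?q" by (intro form_scale form_add form_2_mult form_nth)
    moreover have "?q (axis 1 1) \<noteq> 0" using \<mu>(1) by (simp add: axis_def)
    ultimately show ?thesis unfolding dominates_square_def by blast
  next
    case two
    then obtain T :: "real^3 \<Rightarrow> real^3" where
      T: "linear T" "inj T" "T (axis 1 1) = p" "T (axis 2 1) = q"
      using exists_frame[of p q] unfolding ind_def by blast
    obtain k where k: "(\<lambda>v. F (T v)) = quartic k"
      using form_4_coeffs[OF form_compose_linear[OF form T(1)]] by blast
    have FT: "quartic k v = F (T v)" for v using fun_cong[OF k, of v] by simp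
    have nnk: "0 \<le> quartic k v" for v by (simp add: FT nn)
    have k0: "k 0 = 0" "k 1 = 0" "k 2 = 0" "k 10 = 0" "k 6 = 0" "k 11 = 0"
      using quartic_zero_at_axis_1[OF nnk] quartic_zero_at_axis_2[OF nnk]
      by (simp_all add: FT T two)
    obtain S where S: "\<And>v. T (S v) = v"
      using linear_injective_isomorphism[OF T(1,2)] by blast
    have "dominates_square (quartic k)"
    proof (rule dominates_square_two_zeros)
      show "quartic k v = (v$1)^2 * bquad (k 3) (k 4 / 2) (k 5) (v$2) (v$3)
        + 2 * (v$1 * v$3) * bquad (k 7 / 2) (k 8 / 4) (k 9 / 2) (v$2) (v$3)
        + (v$3)^2 * bquad (k 12) (k 13 / 2) (k 14) (v$2) (v$3)" for v
        by (simp add: quartic_def k0 k0[simplified] bquad_def algebra_simps power2_eq_square power3_eq_cube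
            power4_eq_xxxx)
      show "quartic k (S w) \<noteq> 0" by (simp add: FT S w)
    qed (rule nnk)
    then show ?thesis using dominates_square_transfer[OF _ T(1,2)] k by simp
  next
    case one
    obtain q where "ind p q"
    proof (cases "p$1 = 0")
      case True
      have "ind p (axis 1 1)" unfolding ind_def
      proof (intro allI impI)
        fix a b :: real assume e: "a *\<^sub>R p + b *\<^sub>R axis 1 1 = 0"
        then have "(a *\<^sub>R p + b *\<^sub>R axis 1 1) $ 1 = 0" by simp
        then have "b = 0" using True by (simp add: axis_def)
        with e one(1) show "a = 0 \<and> b = 0" by simp
      qed
      then show ?thesis by (rule that)
    next
      case False
      have "ind p (axis 2 1)" unfolding ind_def
      proof (intro allI impI)
        fix a b :: real assume e: "a *\<^sub>R p + b *\<^sub>R axis 2 1 = 0"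
        then have "(a *\<^sub>R p + b *\<^sub>R axis 2 1) $ 1 = 0" by simp
        then have "a = 0" using False by (simp add: axis_def)
        with e show "a = 0 \<and> b = 0" by (simp add: axis_eq_0_iff)
      qed
      then show ?thesis by (rule that)
    qed
    then obtain T :: "real^3 \<Rightarrow> real^3" where
      T: "linear T" "inj T" "T (axis 1 1) = p"
      using exists_frame[of p q] unfolding ind_def by blast
    obtain k where k: "(\<lambda>v. F (T v)) = quartic k"
      using form_4_coeffs[OF form_compose_linear[OF form T(1)]] by blast
    have FT: "quartic k v = F (T v)" for v using fun_cong[OF k, of v] by simp
    have nnk: "0 \<le> quartic k v" for v by (simp add: FT nn)
    have k0: "k 0 = 0" "k 1 = 0" "k 2 = 0"
      using quartic_zero_at_axis_1[OF nnk] by (simp_all add: FT T one)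
    have "dominates_square (quartic k)"
    proof (rule dominates_square_one_zero)
      show "quartic k v = (v$1)^2 * bquad (k 3) (k 4 / 2) (k 5) (v$2) (v$3)
        + 2 * v$1 * bcubic (k 6 / 2) (k 7 / 2) (k 8 / 2) (k 9 / 2) (v$2) (v$3)
        + bquartic (k 10) (k 11) (k 12) (k 13) (k 14) (v$2) (v$3)" for v
        by (simp add: quartic_def k0 k0[simplified] bquad_def bcubic_def bquartic_def algebra_simps)
      show "0 \<le> quartic k v" for v by (rule nnk)
      fix v assume "quartic k v = 0"
      then have "\<not> ind p (T v)" using one(3) by (simp add: FT)
      then obtain a b where ab: "a *\<^sub>R p + b *\<^sub>R T v = 0" "a \<noteq> 0 \<or> b \<noteq> 0"
        unfolding ind_def by blast
      have "T (a *\<^sub>R axis 1 1 + b *\<^sub>R v) = T 0"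
        using ab(1) T by (simp add: linear_add linear_scale linear_0)
      then have e: "a *\<^sub>R axis 1 1 + b *\<^sub>R v = 0" using T(2) by (simp add: inj_def)
      have "b \<noteq> 0" using ab one(1) by auto
      moreover have "b * v$2 = 0" "b * v$3 = 0"
        using arg_cong[OF e, of "\<lambda>u. u$2"] arg_cong[OF e, of "\<lambda>u. u$3"] by (simp_all add: axis_def)
      ultimately show "v$2 = 0 \<and> v$3 = 0" by simp
    qed
    then show ?thesis using dominates_square_transfer[OF _ T(1,2)] k by simp
  qed
qed

section \<open>Forms as functionals on the Veronese space\<close>

lemma coord_linear [simp]:
  "coord (x + y) a b c = coord x a b c + coord y a b c"
  "coord (t *\<^sub>R x) a b c = t * coord x a b c"
  by (simp_all add: coord_def)

lemma form_4_functional: "form 4 (\<lambda>v. inner c (veronese4 v))"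
proof -
  have prod: "form (\<Sum>i\<in>UNIV. Rep_quartic_exp \<alpha> $ i) (\<lambda>v::real^3. \<Prod>i\<in>UNIV. (v $ i) ^ (Rep_quartic_exp \<alpha> $ i))"
    for \<alpha>
    using form_power[OF form_nth] by (intro form_prod) auto
  have "form 4 (\<lambda>v::real^3. \<Prod>i\<in>UNIV. (v $ i) ^ (Rep_quartic_exp \<alpha> $ i))" for \<alpha>
    using prod[of \<alpha>] Rep_quartic_exp[of \<alpha>] by simp
  then show ?thesis
    unfolding inner_vec_def veronese4_def by (auto intro!: form_sum form_scale)
qed

lemma UNIV_prod_3: "prod f (UNIV::3 set) = f 1 * f 2 * f 3" for f :: "3 \<Rightarrow> real"
  unfolding UNIV_3 by (simp add: mult.assoc)

text \<open>Linear independence of the monomials of degree four. On the curve \<open>(1, t, t\<^sup>5)\<close> they restrict to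
  powers of \<open>t\<close> with distinct exponents, since all exponents are less than five, and a real
  polynomial in one variable that vanishes identically has zero coefficients.\<close>

lemma veronese4_total:
  assumes "\<And>v. inner c (veronese4 v) = 0"
  shows "c = 0"
proof -
  define e where "e \<alpha> = Rep_quartic_exp \<alpha> $ 2 + 5 * Rep_quartic_exp \<alpha> $ 3" for \<alpha>
  have inj: "\<alpha> = \<beta>" if "e \<alpha> = e \<beta>" for \<alpha> \<beta>
  proof -
    have "Rep_quartic_exp \<alpha> $ 1 + Rep_quartic_exp \<alpha> $ 2 + Rep_quartic_exp \<alpha> $ 3 = 4"
      "Rep_quartic_exp \<beta> $ 1 + Rep_quartic_exp \<beta> $ 2 + Rep_quartic_exp \<beta> $ 3 = 4"
      using Rep_quartic_exp[of \<alpha>] Rep_quartic_exp[of \<beta>] by (simp_all add: sum_3)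
    moreover from this have "Rep_quartic_exp \<alpha> $ 3 = Rep_quartic_exp \<beta> $ 3"
      using that unfolding e_def by linarith
    ultimately have "Rep_quartic_exp \<alpha> = Rep_quartic_exp \<beta>"
      using that by (simp add: e_def Finite_Cartesian_Product.vec_eq_iff forall_3)
    then show ?thesis by (simp add: Rep_quartic_exp_inject)
  qed
  define p where "p = (\<Sum>\<alpha>\<in>UNIV. monom (c $ \<alpha>) (e \<alpha>))"
  have "veronese4 (vector [1, t, t^5]) $ \<alpha> = t ^ e \<alpha>" for t \<alpha>
    by (simp only: veronese4_def e_def power_add power_mult UNIV_prod_3 vec_lambda_beta vector_3
        power_one mult_1)
  then have "poly p t = inner c (veronese4 (vector [1, t, t^5]))" for t
    unfolding p_def inner_vec_def by (simp add: poly_sum poly_monom)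
  then have "p = 0" using assms poly_all_0_iff_0[of p] by simp
  moreover have "Polynomial.coeff p (e \<alpha>) = c $ \<alpha>" for \<alpha>
  proof -
    have "Polynomial.coeff p (e \<alpha>) = (\<Sum>\<beta>\<in>UNIV. if \<beta> = \<alpha> then c $ \<beta> else 0)"
      unfolding p_def coeff_sum by (rule sum.cong) (use inj in auto)
    then show ?thesis by simp
  qed
  ultimately show ?thesis by (simp add: Finite_Cartesian_Product.vec_eq_iff)
qed

text \<open>For fixed \<open>a\<close> this is linear in \<open>l\<close>: it is the value of \<open>l\<close>, read as a functional on quartics,
  at the square of \<open>conic a\<close>.\<close>

definition hankel_form :: "(nat \<Rightarrow> real) \<Rightarrow> real ^ quartic_exp \<Rightarrow> real" where
  "hankel_form a l = (\<Sum>i<6. \<Sum>j<6. a i * a j * hankel_mat l $$ (i, j))"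

text \<open>The exponent of the variable number \<open>n\<close> (counted from 0) in the monomial that labels row \<open>i\<close> of the
  Hankel matrix.\<close>

definition quadric_exp :: "nat \<Rightarrow> nat \<Rightarrow> nat" where
  "quadric_exp n i = [[2, 0, 0, 1, 1, 0], [0, 2, 0, 1, 0, 1], [0, 0, 2, 0, 1, 1]] ! n ! i"

lemma less_6_cases:
  assumes "i < (6::nat)" obtains "i = 0" | "i = 1" | "i = 2" | "i = 3" | "i = 4" | "i = 5"
  using assms by linarith

lemma hankel_mat_entry:
  assumes "i < 6" "j < 6"
  shows "hankel_mat l $$ (i, j) = coord l (quadric_exp 0 i + quadric_exp 0 j)
     (quadric_exp 1 i + quadric_exp 1 j) (quadric_exp 2 i + quadric_exp 2 j)"
  using assms
  by (elim less_6_cases) (simp_all add: hankel_mat_def mat_of_rows_list_def quadric_exp_def numeral_eq_Suc)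

lemma hankel_mat_carrier: "hankel_mat l \<in> carrier_mat 6 6"
  by (intro carrier_matI) (simp_all add: hankel_mat_def mat_of_rows_list_def)

lemma hankel_mat_sym: "i < 6 \<Longrightarrow> j < 6 \<Longrightarrow> hankel_mat l $$ (i, j) = hankel_mat l $$ (j, i)"
  by (simp add: hankel_mat_entry add.commute)

lemma linear_hankel_entry: "i < 6 \<Longrightarrow> j < 6 \<Longrightarrow> linear (\<lambda>l. hankel_mat l $$ (i, j))"
  by (intro linearI) (simp_all add: hankel_mat_entry)

lemma linear_hankel_form: "linear (hankel_form a)"
  unfolding hankel_form_def
  by (intro linearI)
     (simp_all add: hankel_mat_entry sum_distrib_left mult_ac flip: sum.distrib, simp_all add: algebra_simps)

lemma conic_monomials:
  "conic a v = (\<Sum>i<6. a i * (v$1 ^ quadric_exp 0 i * v$2 ^ quadric_exp 1 i * v$3 ^ quadric_exp 2 i))"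
  by (simp add: conic_def quadric_exp_def eval_nat_numeral)

lemma hankel_form_veronese4: "hankel_form a (veronese4 v) = (conic a v)^2"
proof -
  let ?m = "\<lambda>i. v$1 ^ quadric_exp 0 i * v$2 ^ quadric_exp 1 i * v$3 ^ quadric_exp 2 i"
  have "hankel_mat (veronese4 v) $$ (i, j) = ?m i * ?m j" if "i < 6" "j < 6" for i j
  proof -
    have deg: "quadric_exp 0 i + quadric_exp 1 i + quadric_exp 2 i = 2" if "i < 6" for i
      using that by (elim less_6_cases) (simp_all add: quadric_exp_def)
    show ?thesis
      unfolding hankel_mat_entry[OF that]
      by (subst coord_veronese4) (use deg[OF that(1)] deg[OF that(2)] in \<open>simp_all add: power_add mult_ac\<close>)
  qed
  then have "hankel_form a (veronese4 v) = (\<Sum>i<6. \<Sum>j<6. (a i * ?m i) * (a j * ?m j))"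
    unfolding hankel_form_def by (intro sum.cong refl) (simp add: mult_ac)
  then show ?thesis
    by (simp add: conic_monomials power2_eq_square sum_product)
qed

lemma psd_mat_iff:
  assumes "A \<in> carrier_mat m m"
  shows "psd_mat A \<longleftrightarrow> (\<forall>i<m. \<forall>j<m. A $$ (i, j) = A $$ (j, i)) \<and>
    (\<forall>a :: nat \<Rightarrow> real. 0 \<le> (\<Sum>i<m. \<Sum>j<m. a i * a j * A $$ (i, j)))"
proof -
  have sq: "square_mat A" and d: "dim_row A = m" "dim_col A = m" using assms by auto
  have "transpose_mat A = A \<longleftrightarrow> (\<forall>i<m. \<forall>j<m. A $$ (i, j) = A $$ (j, i))"
    using d by (auto simp: mat_eq_iff)
  moreover have prod: "scalar_prod v (A *\<^sub>v v)
      = (\<Sum>i<m. \<Sum>j<m. vec_index v i * vec_index v j * A $$ (i, j))" if "v \<in> carrier_vec m" for v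
    using that d by (simp add: scalar_prod_def sum_distrib_left atLeast0LessThan mult_ac)
  have "(\<forall>v \<in> carrier_vec m. 0 \<le> scalar_prod v (A *\<^sub>v v)) \<longleftrightarrow>
      (\<forall>a :: nat \<Rightarrow> real. 0 \<le> (\<Sum>i<m. \<Sum>j<m. a i * a j * A $$ (i, j)))"
  proof (intro iffI allI ballI)
    fix a :: "nat \<Rightarrow> real"
    assume "\<forall>v \<in> carrier_vec m. 0 \<le> scalar_prod v (A *\<^sub>v v)"
    then have "0 \<le> scalar_prod (Matrix.vec m a) (A *\<^sub>v Matrix.vec m a)" by simp
    then show "0 \<le> (\<Sum>i<m. \<Sum>j<m. a i * a j * A $$ (i, j))" by (simp add: prod)
  qed (simp add: prod)
  ultimately show ?thesis unfolding psd_mat_def using sq d by simp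
qed

lemma psd_hankel_mat_iff: "psd_mat (hankel_mat l) \<longleftrightarrow> (\<forall>a. 0 \<le> hankel_form a l)"
  using psd_mat_iff[OF hankel_mat_carrier] hankel_mat_sym unfolding hankel_form_def by blast

definition norm4_functional :: "real ^ quartic_exp \<Rightarrow> real" where
  "norm4_functional l = coord l 4 0 0 + coord l 0 4 0 + coord l 0 0 4
     + 2 * coord l 2 2 0 + 2 * coord l 2 0 2 + 2 * coord l 0 2 2"

lemma linear_norm4_functional: "linear norm4_functional"
  by (intro linearI) (simp_all add: norm4_functional_def algebra_simps)

lemma norm4_functional_veronese4: "norm4_functional (veronese4 v) = norm v ^ 4"
proof -
  have "norm v ^ 4 = (norm v ^ 2) ^ 2" by simp
  also have "\<dots> = norm4_functional (veronese4 v)"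
    unfolding norm_square_3
    by (simp add: norm4_functional_def coord_veronese4 algebra_simps power2_eq_square power4_eq_xxxx)
  finally show ?thesis by simp
qed

section \<open>Duality\<close>

text \<open>The nonnegative ternary quartics, given by their coefficient vectors.\<close>

definition psd_cone :: "(real ^ quartic_exp) set" where
  "psd_cone = {c. \<forall>v. 0 \<le> inner c (veronese4 v)}"

lemma closed_psd_cone: "closed psd_cone"
  unfolding psd_cone_def by (intro closed_Collect_all closed_Collect_le continuous_intros)

lemma functional_as_vector:
  fixes f :: "'a::euclidean_space \<Rightarrow> real"
  assumes "linear f" shows "\<exists>c. \<forall>x. inner c x = f x"
  using adjoint_works[OF assms, of _ 1] by (metis inner_commute inner_real_def mult.right_neutral)

text \<open>Sum the evaluations at points whose Veronese images form a basis of their span. A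
  nonnegative quartic on which the sum vanishes is zero at all these points, hence identically.\<close>

lemma strictly_positive_functional:
  "\<exists>s. \<forall>c\<in>psd_cone. c \<noteq> 0 \<longrightarrow> 0 < inner c s"
proof -
  obtain B where B: "B \<subseteq> range veronese4" "independent B" "range veronese4 \<subseteq> span B"
    by (rule basis_exists)
  have fin: "finite B" using B(2) independent_imp_finite by blast
  have "0 < inner c (\<Sum>B)" if c: "c \<in> psd_cone" "c \<noteq> 0" for c
  proof (rule ccontr)
    have nn: "0 \<le> inner c b" if "b \<in> B" for b using B(1) c(1) that by (auto simp: psd_cone_def)
    assume "\<not> 0 < inner c (\<Sum>B)"
    moreover have "0 \<le> (\<Sum>b\<in>B. inner c b)" using nn by (rule sum_nonneg)
    ultimately have "(\<Sum>b\<in>B. inner c b) = 0" by (simp add: inner_sum_right)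
    then have "\<forall>b\<in>B. inner c b = 0" using sum_nonneg_eq_0_iff[OF fin, of "inner c"] nn by blast
    then have "inner c x = 0" if "x \<in> span B" for x
      using orthogonal_to_span[OF that, of c] by (simp add: real_inner_class.orthogonal_def)
    then have "inner c (veronese4 v) = 0" for v using B(3) by blast
    then show False using veronese4_total c(2) by blast
  qed
  then show ?thesis by blast
qed

text \<open>Here the Choi-Lam property replaces a decomposition into squares. Let \<open>m\<close> be the minimum over the
  nonzero nonnegative quartics of the quotient of \<open>l\<close> by a strictly positive functional \<open>s\<close>. If it were negative,
  subtracting a dominated square from a minimiser \<open>c0\<close> would stay in the cone. As \<open>c0\<close> attains
  \<open>l = m s\<close> and the difference satisfies \<open>l \<ge> m s\<close>, the functional \<open>l\<close> would be at most \<open>m s < 0\<close> on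
  the square, but semidefiniteness of the Hankel matrix says that it is nonnegative on squares.\<close>

lemma hankel_nonneg_on_psd_cone:
  assumes hank: "\<And>a. 0 \<le> hankel_form a l" and c: "c \<in> psd_cone"
  shows "0 \<le> inner c l"
proof (rule ccontr)
  assume neg: "\<not> 0 \<le> inner c l"
  obtain s where s: "\<And>c. c \<in> psd_cone \<Longrightarrow> c \<noteq> 0 \<Longrightarrow> 0 < inner c s"
    using strictly_positive_functional by blast
  define K where "K = psd_cone \<inter> sphere 0 1"
  have "compact K" unfolding K_def by (intro closed_Int_compact closed_psd_cone compact_sphere)
  have normalize: "(1 / norm x) *\<^sub>R x \<in> K" if "x \<in> psd_cone" "x \<noteq> 0" for x
    using that by (simp add: K_def psd_cone_def)
  have posK: "0 < inner x s" if "x \<in> K" for x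
  proof (rule s)
    show "x \<in> psd_cone" "x \<noteq> 0" using that by (auto simp: K_def)
  qed
  have "c \<noteq> 0" using neg by auto
  then have "K \<noteq> {}" using normalize[OF c] by blast
  moreover have "continuous_on K (\<lambda>x. inner x l / inner x s)"
    using posK by (intro continuous_intros) force
  ultimately obtain c0 where c0: "c0 \<in> K"
    and min: "\<And>x. x \<in> K \<Longrightarrow> inner c0 l / inner c0 s \<le> inner x l / inner x s"
    using continuous_attains_inf[OF \<open>compact K\<close>] by blast
  define m where "m = inner c0 l / inner c0 s"
  have c0m: "inner c0 l = m * inner c0 s" using posK[OF c0] by (simp add: m_def)
  have bound: "m * inner x s \<le> inner x l" if "x \<in> psd_cone" for x
  proof (cases "x = 0")
    case False
    have "m \<le> inner x l / inner x s"
      using min[OF normalize[OF that False]] False by (simp add: m_def)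
    then show ?thesis using s[OF that False] by (simp add: field_simps)
  qed simp
  have "m < 0"
  proof (rule ccontr)
    assume "\<not> m < 0"
    then have "0 \<le> m * inner c s" using s[OF c \<open>c \<noteq> 0\<close>] by simp
    then show False using bound[OF c] neg by linarith
  qed
  have c0': "c0 \<in> psd_cone" "c0 \<noteq> 0" using c0 by (auto simp: K_def)
  obtain w0 where "inner c0 (veronese4 w0) \<noteq> 0" using veronese4_total c0'(2) by blast
  then have "dominates_square (\<lambda>v. inner c0 (veronese4 v))"
    using c0'(1) by (intro nonneg_ternary_quartic_dominates_square form_4_functional)
      (auto simp: psd_cone_def)
  then obtain q u where q: "form 2 q" "q u \<noteq> 0" "\<And>v. (q v)^2 \<le> inner c0 (veronese4 v)"
    unfolding dominates_square_def by blast
  obtain a where a: "q = conic a" using form_2_coeffs[OF q(1)] by blast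
  obtain w where w: "\<And>x. inner w x = hankel_form a x"
    using functional_as_vector[OF linear_hankel_form] by blast
  have wq: "inner w (veronese4 v) = (q v)^2" for v by (simp add: w a hankel_form_veronese4)
  have "w \<in> psd_cone" by (simp add: psd_cone_def wq)
  moreover have "w \<noteq> 0" using wq[of u] q(2) by auto
  ultimately have ws: "0 < inner w s" by (rule s)
  have "c0 - w \<in> psd_cone" using q(3) by (simp add: psd_cone_def inner_diff_left wq)
  from bound[OF this] have "inner w l \<le> m * inner w s"
    by (simp add: inner_diff_left c0m algebra_simps)
  also have "\<dots> < 0" using ws \<open>m < 0\<close> by (simp add: mult_less_0_iff)
  finally show False using hank[of a] by (simp add: w)
qed

lemma continuous_on_veronese4: "continuous_on S veronese4"
  unfolding veronese4_def by (intro continuous_on_vec_lambda continuous_intros)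

text \<open>For the inclusion from right to left, a point outside the orbitope is strictly separated from it
  by an affine function. The functional \<open>norm4_functional\<close> is constantly 1 on both sides, so its
  multiples absorb the constant, and the separating functional becomes a quartic that is positive on
  the sphere but negative at the point.\<close>

lemma veronese_orbitope_eq:
  "veronese_orbitope_3_4 = {l. (\<forall>a. 0 \<le> hankel_form a l) \<and> norm4_functional l = 1}" (is "_ = ?R")
proof (rule antisym)
  show "veronese_orbitope_3_4 \<subseteq> ?R"
    unfolding veronese_orbitope_3_4_def
  proof (rule hull_minimal)
    show "veronese4 ` sphere 0 1 \<subseteq> ?R"
      by (auto simp: hankel_form_veronese4 norm4_functional_veronese4)
    show "convex ?R"
      by (auto simp: convex_def linear_add[OF linear_hankel_form] linear_scale[OF linear_hankel_form]
          linear_add[OF linear_norm4_functional] linear_scale[OF linear_norm4_functional])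
  qed
next
  show "?R \<subseteq> veronese_orbitope_3_4"
  proof (rule subsetI, rule ccontr)
    fix l assume l: "l \<in> ?R" "l \<notin> veronese_orbitope_3_4"
    have "compact veronese_orbitope_3_4"
      unfolding veronese_orbitope_3_4_def
      by (intro compact_convex_hull compact_continuous_image continuous_on_veronese4 compact_sphere)
    moreover have "convex veronese_orbitope_3_4" by (simp add: veronese_orbitope_3_4_def)
    ultimately obtain c b where c: "inner c l < b" "\<And>x. x \<in> veronese_orbitope_3_4 \<Longrightarrow> b < inner c x"
      using separating_hyperplane_closed_point[of veronese_orbitope_3_4 l] l(2) compact_imp_closed by blast
    obtain n where n: "\<And>x. inner n x = norm4_functional x"
      using functional_as_vector[OF linear_norm4_functional] by blast
    define d where "d = c - b *\<^sub>R n"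
    have d: "inner d x = inner c x - b * norm4_functional x" for x
      by (simp add: d_def inner_diff_left n)
    have sphere: "0 < inner d (veronese4 u)" if "norm u = 1" for u
    proof -
      have "veronese4 u \<in> veronese_orbitope_3_4"
        unfolding veronese_orbitope_3_4_def using that by (intro hull_inc) auto
      then show ?thesis using c(2) that by (simp add: d norm4_functional_veronese4)
    qed
    have hom: "inner d (veronese4 (t *\<^sub>R v)) = t ^ 4 * inner d (veronese4 v)" for t v
      using form_homogeneous[OF form_4_functional] .
    have "0 \<le> inner d (veronese4 v)" for v
    proof (cases "v = 0")
      case True
      then show ?thesis using hom[of 0 v] by simp
    next
      case False
      then show ?thesis
        using hom[of "norm v" "(1 / norm v) *\<^sub>R v"] sphere[of "(1 / norm v) *\<^sub>R v"] by simp
    qed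
    then have "0 \<le> inner d l"
      using l(1) by (intro hankel_nonneg_on_psd_cone) (auto simp: psd_cone_def)
    then show False using c(1) l(1) by (simp add: d)
  qed
qed

section \<open>The spectrahedron\<close>

lemma linear_eq_sum_axis:
  fixes \<phi> :: "real ^ 'n \<Rightarrow> real"
  assumes "linear \<phi>"
  shows "\<phi> x = (\<Sum>k\<in>UNIV. x $ k * \<phi> (axis k 1))"
proof -
  have "\<phi> x = \<phi> (\<Sum>k\<in>UNIV. x $ k *\<^sub>R axis k 1)"
    using basis_expansion[of x] by (simp add: scalar_mult_eq_scaleR)
  also have "\<dots> = (\<Sum>k\<in>UNIV. x $ k * \<phi> (axis k 1))"
    using assms by (simp add: linear_sum linear_scale)
  finally show ?thesis .
qed

lemma spectrahedron_linear_matrix_inequality: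
  fixes \<phi> :: "nat \<Rightarrow> nat \<Rightarrow> real ^ 'n \<Rightarrow> real" and c :: "nat \<Rightarrow> nat \<Rightarrow> real"
  assumes "\<And>i j. i < m \<Longrightarrow> j < m \<Longrightarrow> linear (\<phi> i j)"
    and "\<And>i j. i < m \<Longrightarrow> j < m \<Longrightarrow> \<phi> i j = \<phi> j i" "\<And>i j. i < m \<Longrightarrow> j < m \<Longrightarrow> c i j = c j i"
  shows "spectrahedron {x. psd_mat (Matrix.mat m m (\<lambda>(i, j). c i j + \<phi> i j x))}"
proof -
  let ?C = "Matrix.mat m m (\<lambda>(i, j). c i j)"
  let ?A = "\<lambda>k. Matrix.mat m m (\<lambda>(i, j). \<phi> i j (axis k 1))"
  have "affine_pencil m ?C ?A x = Matrix.mat m m (\<lambda>(i, j). c i j + \<phi> i j x)" for x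
    unfolding affine_pencil_def using linear_eq_sum_axis[OF assms(1)] by (intro eq_matI) auto
  moreover have "transpose_mat ?C = ?C" "\<And>k. transpose_mat (?A k) = ?A k"
    using assms(2,3) by (auto simp: mat_eq_iff)
  ultimately show ?thesis
    unfolding spectrahedron_def
    by (intro exI[of _ m] exI[of _ ?C] exI[of _ ?A]) simp
qed

text \<open>With \<open>N\<close> for the value of \<open>norm4_functional\<close>, the equation \<open>N = 1\<close> is the pair of inequalities
  \<open>0 \<le> N - 1\<close> and \<open>0 \<le> 1 - N\<close>, entered as two additional
  diagonal entries below the Hankel matrix.\<close>

lemma spectrahedron_veronese_orbitope: "spectrahedron veronese_orbitope_3_4"
proof -
  define \<phi> where "\<phi> i j l = (if i < 6 \<and> j < 6 then hankel_mat l $$ (i, j)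
      else if i = 6 \<and> j = 6 then norm4_functional l
      else if i = 7 \<and> j = 7 then - norm4_functional l else 0)" for i j :: nat and l
  define c :: "nat \<Rightarrow> nat \<Rightarrow> real" where
    "c i j = (if i = 6 \<and> j = 6 then -1 else if i = 7 \<and> j = 7 then 1 else 0)" for i j
  let ?M = "\<lambda>l. Matrix.mat 8 8 (\<lambda>(i, j). c i j + \<phi> i j l)"
  have lin: "linear (\<phi> i j)" for i j
    unfolding \<phi>_def using linear_hankel_entry[of i j] linear_norm4_functional
    by (cases "i < 6 \<and> j < 6") (auto simp: linear_iff algebra_simps)
  have sym: "\<phi> i j = \<phi> j i" "c i j = c j i" for i j
    by (auto simp: \<phi>_def c_def hankel_mat_sym fun_eq_iff)
  have form8: "(\<Sum>i<8. \<Sum>j<8. a i * a j * ?M l $$ (i, j)) = hankel_form a l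
      + ((a 6)^2 - (a 7)^2) * (norm4_functional l - 1)" for a l
  proof -
    have 8: "{..<8} = insert 7 (insert 6 {..<6::nat})" by auto
    have "(\<Sum>i<8. \<Sum>j<8. a i * a j * ?M l $$ (i, j))
      = (\<Sum>i<8. \<Sum>j<8. a i * a j * (c i j + \<phi> i j l))"
      by (intro sum.cong) auto
    also have "\<dots> = hankel_form a l + ((a 6)^2 - (a 7)^2) * (norm4_functional l - 1)"
      unfolding 8 by (simp add: c_def \<phi>_def hankel_form_def algebra_simps power2_eq_square)
    finally show ?thesis .
  qed
  have "psd_mat (?M l) \<longleftrightarrow> (\<forall>a. 0 \<le> hankel_form a l) \<and> norm4_functional l = 1" for l
  proof -
    have "psd_mat (?M l) \<longleftrightarrow> (\<forall>a. 0 \<le> hankel_form a l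
        + ((a 6)^2 - (a 7)^2) * (norm4_functional l - 1))"
      using psd_mat_iff[of "?M l" 8] sym unfolding form8 by simp
    also have "\<dots> \<longleftrightarrow> (\<forall>a. 0 \<le> hankel_form a l) \<and> norm4_functional l = 1"
    proof (intro iffI conjI allI)
      assume *: "\<forall>a. 0 \<le> hankel_form a l + ((a 6)^2 - (a 7)^2) * (norm4_functional l - 1)"
      have "0 \<le> norm4_functional l - 1"
        using *[rule_format, of "\<lambda>i. if i = 6 then 1 else 0"] by (simp add: hankel_form_def)
      moreover have "0 \<le> 1 - norm4_functional l"
        using *[rule_format, of "\<lambda>i. if i = 7 then 1 else 0"] by (simp add: hankel_form_def)
      ultimately show "norm4_functional l = 1" by simp
      then show "0 \<le> hankel_form a l" for a using *[rule_format, of a] by simp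
    qed simp
    finally show ?thesis .
  qed
  then have "veronese_orbitope_3_4 = {l. psd_mat (?M l)}" by (simp add: veronese_orbitope_eq)
  then show ?thesis using spectrahedron_linear_matrix_inequality[of 8 \<phi> c] lin sym by simp
qed

theorem theorem6p1:
  shows "spectrahedron veronese_orbitope_3_4 \<and>
    veronese_orbitope_3_4 =
      {l :: real ^ quartic_exp. psd_mat (hankel_mat l) \<and>
         coord l 4 0 0 + coord l 0 4 0 + coord l 0 0 4
           + 2 * coord l 2 2 0 + 2 * coord l 2 0 2 + 2 * coord l 0 2 2 = 1}"
  using spectrahedron_veronese_orbitope veronese_orbitope_eq
  by (simp add: psd_hankel_mat_iff norm4_functional_def)

end
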